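(* Let $0<\sigma^2\le 1$ and $n\ge 2$. Let $\bar A=\bar T+\bar D+\bar T^{T}$ be an arbitrary $n\times n$ real symmetric matrix satisfying $\|\bar A\|_2\le 1$, where $\bar T$ is lower-triangular with zeros on the diagonal and $\bar D$ is diagonal. Let $T$ be a zero-preserving perturbation of $\bar T$ of variance $\sigma^2$, let $G_D$ be a diagonal matrix whose diagonal entries are independent Gaussian random variables of mean $0$ and variance $\sigma^2$ that are independent of $T$, let $D=\bar D+G_D$, and let $A=T+D+T^{T}$. Then for all $x\ge\sqrt{\frac2\pi}\,\frac1{\sigma^2}$, $$\Pr\left[\rho_L(A)>x\right]\le \frac{3.2\,n^4}{x\,\sigma^2}\,\ln^{3/2}\left(e\sqrt{\frac\pi2}\,x\,\sigma^2\right).$$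
   Context: $\|\cdot\|_2$ is the operator norm induced by the Euclidean norm; $\|\cdot\|_\infty$ of a matrix is the maximum absolute row sum. The zero-preserving perturbation of a matrix $\bar T$ of variance $\sigma^2$ is the random matrix $T$ obtained by adding independent Gaussian random variables of mean $0$ and variance $\sigma^2$ to the non-zero entries of $\bar T$ (zero entries are left unchanged). With probability 1, $A$ has a unique LU-factorization (without pivoting) $A=LU$, where $L$ is lower-triangular with $1$s on the diagonal and $U$ is upper-triangular. The growth factor is $\rho_L(A)=\|L\|_\infty$. $\ln^{3/2}(y)$ means $(\ln y)^{3/2}$. *)

theory Defs
  imports "HOL-Probability.Probability"
begin

text \<open>
  Square matrices are indexed by a finite well-ordered type \<open>'n\<close>, as in the library's
  \<open>det_lowerdiagonal\<close>; the entry in row \<open>i\<close>, column \<open>j\<close> of \<open>A\<close>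
  is \<open>A $ i $ j\<close>, and the dimension is \<open>CARD('n)\<close>.
\<close>

definition lower_triangular :: "real^'n::{finite,wellorder}^'n::{finite,wellorder} \<Rightarrow> bool" where
  "lower_triangular A \<longleftrightarrow> (\<forall>i j. i < j \<longrightarrow> A $ i $ j = 0)"

definition upper_triangular :: "real^'n::{finite,wellorder}^'n::{finite,wellorder} \<Rightarrow> bool" where
  "upper_triangular A \<longleftrightarrow> (\<forall>i j. j < i \<longrightarrow> A $ i $ j = 0)"

definition diagonal :: "real^'n^'n \<Rightarrow> bool" where
  "diagonal A \<longleftrightarrow> (\<forall>i j. i \<noteq> j \<longrightarrow> A $ i $ j = 0)"

definition row_sum_norm :: "real^'n^'m \<Rightarrow> real" where
  "row_sum_norm A = Max (range (\<lambda>i. \<Sum>j\<in>UNIV. \<bar>A $ i $ j\<bar>))"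

definition LU_factorization ::
    "real^'n::{finite,wellorder}^'n::{finite,wellorder} \<Rightarrow> (real^'n::{finite,wellorder}^'n::{finite,wellorder}) \<times>
     (real^'n::{finite,wellorder}^'n::{finite,wellorder}) \<Rightarrow> bool" where
  "LU_factorization A = (\<lambda>(L, U).
     lower_triangular L \<and> (\<forall>i. L $ i $ i = 1) \<and> upper_triangular U \<and> A = L ** U)"

text \<open>
  The factorization exists and is unique precisely when the leading principal minors of orders
  \<open>1, \<dots>, n - 1\<close> are all non-zero, an open condition on which \<open>L\<close> is a rational function
  of the entries; so \<open>growth_L\<close> is Borel measurable. The value \<open>\<infinity>\<close> elsewhere puts the
  exceptional matrices (a null event for the random matrices considered) into every tail
  event \<open>growth_L A > x\<close>.
\<close>

definition growth_L :: "real^'n::{finite,wellorder}^'n::{finite,wellorder} \<Rightarrow> ereal" where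
  "growth_L A =
     (if \<exists>!F. LU_factorization A F
      then ereal (row_sum_norm (fst (THE F. LU_factorization A F)))
      else \<infinity>)"

text \<open>
  The second argument of \<^const>\<open>normal_density\<close> is the standard deviation; the density depends
  on \<open>\<sigma>\<close> only through \<open>\<sigma>\<^sup>2\<close>, so the sign of \<open>\<sigma>\<close> is irrelevant.
\<close>

definition indep_gaussians :: "'a measure \<Rightarrow> real \<Rightarrow> ('i \<Rightarrow> 'a \<Rightarrow> real) \<Rightarrow> 'i set \<Rightarrow> bool" where
  "indep_gaussians M \<sigma> X I \<longleftrightarrow>
     prob_space.indep_vars M (\<lambda>_. borel) X I \<and>
     (\<forall>i\<in>I. distributed M lborel (X i) (normal_density 0 \<sigma>))"

definition zero_preserving_perturbation ::
    "'a measure \<Rightarrow> real \<Rightarrow> real^'n^'m \<Rightarrow> ('a \<Rightarrow> real^'n^'m) \<Rightarrow> bool" where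
  "zero_preserving_perturbation M \<sigma> Tbar T \<longleftrightarrow>
     (\<exists>G. indep_gaussians M \<sigma> G {(i, j). Tbar $ i $ j \<noteq> 0} \<and>
          (\<forall>\<omega>\<in>space M. \<forall>i j. T \<omega> $ i $ j =
             (if Tbar $ i $ j = 0 then 0 else Tbar $ i $ j + G (i, j) \<omega>)))"

end

(*
  Write H_k for the leading k x k block of A and v_k for the last column of its inverse.  Where all
  the H_k are invertible, L_ik = (A v_k)_i for i > k.  The rows of A below the block are independent
  of H_k, and given v_k the expected value of the sum of (A v_k)_i^2 over i > k is at most
  n |v_k|^2, so Chebyshev's inequality reduces the tail of column k to a bound for the expectation
  of min(1, s^2 |v_k|^2), s = sqrt n / t.  This is at most 2s times the trace of the imaginary part
  of (H_k - is)^-1.  Conditionally on the other entries, the j-th diagonal entry of the resolvent is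
  a Moebius function of the j-th diagonal entry of A, so the integral of its imaginary part over that
  entry is exactly pi (spectral averaging), and the Gaussian density is bounded by
  1 / sqrt (2 pi sigma^2).  Summing over j and k with t = (x - 1) / n gives
  sqrt (2 pi) n^(7/2) / ((x - 1) |sigma|), which is stronger than the claim whenever the claimed
  bound is less than 1.
*)

theory Submission
  imports Defs
begin

section \<open>Averaging the resolvent over one diagonal entry\<close>

text \<open>For symmetric \<open>H\<close> this is the imaginary part of the j-th diagonal entry of
  (H - is)^-1 = (H + is) (H^2 + s^2)^-1, that is, q_j where (H^2 + s^2) q = s e_j. Cramer's rule
  keeps everything real and gives a quotient of polynomials in the entries, so measurability is
  immediate.\<close>

definition resolvent_diag :: "real \<Rightarrow> real^'n^'n \<Rightarrow> 'n \<Rightarrow> real" where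
  "resolvent_diag s H j =
     det (\<chi> a b. if b = j then (s *\<^sub>R axis j 1 :: real^'n) $ a else (H ** H + s\<^sup>2 *\<^sub>R mat 1) $ a $ b)
     / det (H ** H + s\<^sup>2 *\<^sub>R mat 1)"

definition coord_matrix :: "'n \<Rightarrow> real^'n^'n" where
  "coord_matrix j = (\<chi> a b. if a = j \<and> b = j then 1 else 0)"

section \<open>The equation (H^2 + s^2) q = s e_j\<close>

lemma coord_matrix_mult: "coord_matrix j *v x = x $ j *\<^sub>R axis j 1"
  by (auto simp: vec_eq_iff coord_matrix_def matrix_vector_mult_def axis_def if_distribR
      if_distrib[of "\<lambda>c. c * _"] cong: if_cong)

lemma inner_symmetric_matrix:
  fixes H :: "real^'n^'n"
  assumes "transpose H = H"
  shows "x \<bullet> (H *v y) = (H *v x) \<bullet> y"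
  by (metis assms dot_lmul_matrix transpose_matrix_vector)

lemma resolvent_mult:
  fixes H :: "real^'n^'n"
  shows "(H ** H + s\<^sup>2 *\<^sub>R mat 1) *v q = H *v (H *v q) + s\<^sup>2 *\<^sub>R q"
  by (simp add: matrix_vector_mult_add_rdistrib flip: matrix_vector_mul_assoc scaleR_matrix_vector_assoc)

text \<open>The matrix is positive definite: its quadratic form is |Hx|^2 + s^2 |x|^2.\<close>

lemma det_resolvent_nz:
  fixes H :: "real^'n^'n"
  assumes "transpose H = H" "s > 0"
  shows "det (H ** H + s\<^sup>2 *\<^sub>R mat 1) \<noteq> 0"
proof -
  let ?M = "H ** H + s\<^sup>2 *\<^sub>R mat 1"
  have "x = 0" if "?M *v x = 0" for x
  proof -
    have "0 = x \<bullet> (H *v (H *v x) + s\<^sup>2 *\<^sub>R x)"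
      using that by (simp add: resolvent_mult)
    also have "\<dots> = (norm (H *v x))\<^sup>2 + s\<^sup>2 * (norm x)\<^sup>2"
      by (simp add: inner_right_distrib inner_symmetric_matrix[OF assms(1)] power2_norm_eq_inner)
    finally show "x = 0"
      using \<open>s > 0\<close> by (smt (verit) norm_eq_zero zero_less_power mult_pos_pos zero_le_power2 zero_less_norm_iff)
  qed
  then have "\<exists>B. B ** ?M = mat 1"
    by (subst matrix_left_invertible_ker) blast
  then show ?thesis
    using invertible_det_nz invertible_left_inverse by blast
qed

lemma resolvent_diag_eqI:
  fixes H :: "real^'n^'n"
  assumes "transpose H = H" "s > 0" "H *v (H *v q) + s\<^sup>2 *\<^sub>R q = s *\<^sub>R axis j 1"
  shows "resolvent_diag s H j = q $ j"
proof -
  have "(H ** H + s\<^sup>2 *\<^sub>R mat 1) *v q = s *\<^sub>R axis j 1"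
    using assms(3) by (simp only: resolvent_mult)
  from this[unfolded cramer[OF det_resolvent_nz[OF assms(1,2)]]]
  have "q $ j = (\<chi> k. det (\<chi> a b. if b = k then (s *\<^sub>R axis j 1 :: real^'n) $ a
      else (H ** H + s\<^sup>2 *\<^sub>R mat 1) $ a $ b) / det (H ** H + s\<^sup>2 *\<^sub>R mat 1)) $ j"
    by (rule arg_cong)
  then show ?thesis
    by (simp only: vec_lambda_beta resolvent_diag_def)
qed

text \<open>Pairing the equation with q gives the energy identity. Since the right-hand side is
  non-zero, so is q; hence the energy is positive, and with it q_j.\<close>

lemma resolvent_solution:
  fixes H :: "real^'n^'n"
  assumes "transpose H = H" "s > 0"
  obtains q where "H *v (H *v q) + s\<^sup>2 *\<^sub>R q = s *\<^sub>R axis j 1" "resolvent_diag s H j = q $ j"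
    "s * q $ j = (norm (H *v q))\<^sup>2 + s\<^sup>2 * (norm q)\<^sup>2" "q $ j > 0"
proof -
  obtain q where "(H ** H + s\<^sup>2 *\<^sub>R mat 1) *v q = s *\<^sub>R axis j 1"
    using cramer[OF det_resolvent_nz[OF assms]] by blast
  then have q: "H *v (H *v q) + s\<^sup>2 *\<^sub>R q = s *\<^sub>R axis j 1"
    by (simp only: resolvent_mult)
  have "s * q $ j = q \<bullet> (s *\<^sub>R axis j 1)"
    by (simp add: inner_axis)
  also have "\<dots> = (norm (H *v q))\<^sup>2 + s\<^sup>2 * (norm q)\<^sup>2"
    unfolding q[symmetric]
    by (simp add: inner_right_distrib inner_symmetric_matrix[OF assms(1)] power2_norm_eq_inner)
  finally have eq: "s * q $ j = (norm (H *v q))\<^sup>2 + s\<^sup>2 * (norm q)\<^sup>2" .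
  have "q \<noteq> 0"
  proof
    assume "q = 0"
    then have "(s *\<^sub>R axis j 1 :: real^'n) = 0" using q by simp
    then show False using \<open>s > 0\<close> by (simp add: axis_eq_0_iff)
  qed
  then have "s * q $ j > 0"
    using \<open>s > 0\<close> by (simp add: eq add_nonneg_pos)
  then have "q $ j > 0"
    using \<open>s > 0\<close> by (simp add: zero_less_mult_iff)
  with that q eq show thesis
    using resolvent_diag_eqI[OF assms q] by blast
qed

lemma resolvent_diag_pos:
  assumes "transpose H = H" "s > 0"
  shows "resolvent_diag s H j > 0"
  using resolvent_solution[OF assms] by metis

text \<open>
  \<open>q\<close> represents \<open>y \<mapsto> s y\<^sub>j\<close> in the inner product \<open>\<langle>Hx, Hy\<rangle> + s\<^sup>2\<langle>x, y\<rangle>\<close>, so this is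
  Cauchy--Schwarz for that inner product.
\<close>

lemma coord_sq_le_resolvent_diag:
  fixes H :: "real^'n^'n"
  assumes "transpose H = H" "s > 0"
  shows "s * (y $ j)\<^sup>2 \<le> resolvent_diag s H j * ((norm (H *v y))\<^sup>2 + s\<^sup>2 * (norm y)\<^sup>2)"
proof -
  from resolvent_solution[OF assms, where j = j] obtain q where
    q: "H *v (H *v q) + s\<^sup>2 *\<^sub>R q = s *\<^sub>R axis j 1" "resolvent_diag s H j = q $ j"
    "s * q $ j = (norm (H *v q))\<^sup>2 + s\<^sup>2 * (norm q)\<^sup>2" by metis
  define P where "P x = (H *v x, s *\<^sub>R x)" for x
  have "s * y $ j = y \<bullet> (s *\<^sub>R axis j 1)"
    by (simp add: inner_axis)
  also have "\<dots> = P y \<bullet> P q"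
    unfolding q(1)[symmetric] P_def
    by (simp add: inner_right_distrib inner_symmetric_matrix[OF assms(1)] power2_eq_square)
  finally have "(s * y $ j)\<^sup>2 \<le> (P y \<bullet> P y) * (P q \<bullet> P q)"
    using Cauchy_Schwarz_ineq[of "P y" "P q"] by simp
  moreover have "P x \<bullet> P x = (norm (H *v x))\<^sup>2 + s\<^sup>2 * (norm x)\<^sup>2" for x
    by (simp only: P_def inner_Pair power2_norm_eq_inner) (simp add: power2_eq_square)
  ultimately have "(s * y $ j)\<^sup>2 \<le> ((norm (H *v y))\<^sup>2 + s\<^sup>2 * (norm y)\<^sup>2) * (s * q $ j)"
    by (simp only: q(3))
  then have "s * (s * (y $ j)\<^sup>2) \<le> s * (q $ j * ((norm (H *v y))\<^sup>2 + s\<^sup>2 * (norm y)\<^sup>2))"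
    by (simp only: power_mult_distrib power2_eq_square[of s] mult_ac)
  then show ?thesis
    using \<open>s > 0\<close> q(2) by simp
qed

text \<open>Summing over the support of \<open>y\<close> only matters for \<open>lead k A\<close>:
  its padding rows carry no noise, so their resolvent entries could not be averaged.\<close>

lemma norm_sq_le_sum_resolvent_diag:
  fixes H :: "real^'n^'n"
  assumes "transpose H = H" "s > 0" "\<And>j. j \<notin> K \<Longrightarrow> y $ j = 0"
  shows "s * (norm y)\<^sup>2 \<le> (\<Sum>j\<in>K. resolvent_diag s H j) * ((norm (H *v y))\<^sup>2 + s\<^sup>2 * (norm y)\<^sup>2)"
proof -
  have "(norm y)\<^sup>2 = (\<Sum>j\<in>UNIV. (y $ j)\<^sup>2)"
    by (simp only: power2_norm_eq_inner inner_vec_def) (simp add: power2_eq_square)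
  also have "\<dots> = (\<Sum>j\<in>K. (y $ j)\<^sup>2)"
    by (rule sum.mono_neutral_right) (auto simp: assms(3))
  finally have "s * (norm y)\<^sup>2 = (\<Sum>j\<in>K. s * (y $ j)\<^sup>2)"
    by (simp add: sum_distrib_left)
  also have "\<dots> \<le> (\<Sum>j\<in>K. resolvent_diag s H j * ((norm (H *v y))\<^sup>2 + s\<^sup>2 * (norm y)\<^sup>2))"
    by (intro sum_mono coord_sq_le_resolvent_diag assms)
  finally show ?thesis
    by (simp add: sum_distrib_right)
qed

text \<open>Sherman-Morrison in real form: if z = a + ib is the j-th diagonal entry of (H - is)^-1,
  then adding d to the j-th diagonal entry of \<open>H\<close> turns z into z / (1 + dz), whose
  imaginary part is b / |1 + dz|^2.\<close>

lemma resolvent_diag_rank_one: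
  fixes H :: "real^'n^'n"
  assumes "transpose H = H" "s > 0"
  obtains a b where "b > 0"
    "\<And>d. resolvent_diag s (H + d *\<^sub>R coord_matrix j) j = b / ((1 + d * a)\<^sup>2 + (d * b)\<^sup>2)"
proof -
  let ?e = "axis j 1 :: real^'n"
  from resolvent_solution[OF assms, where j = j] obtain q where
    q: "H *v (H *v q) + s\<^sup>2 *\<^sub>R q = s *\<^sub>R ?e" "q $ j > 0" by metis
  \<comment> \<open>The real part of the resolvent column: (H - is)(p + iq) = e_j splits into Hq =
    sp and Hp = e_j - sq.\<close>
  define p where "p = (1 / s) *\<^sub>R (H *v q)"
  have Hq: "H *v q = s *\<^sub>R p"
    using \<open>s > 0\<close> by (simp add: p_def)
  have Hp: "H *v p = ?e - s *\<^sub>R q"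
  proof -
    have "s *\<^sub>R (H *v p) = s *\<^sub>R (?e - s *\<^sub>R q)"
      using q(1) by (simp add: Hq matrix_vector_mult_scaleR algebra_simps power2_eq_square)
    then show ?thesis using \<open>s > 0\<close> by simp
  qed
  define a b where "a = p $ j" and "b = q $ j"
  have "resolvent_diag s (H + d *\<^sub>R coord_matrix j) j = b / ((1 + d * a)\<^sup>2 + (d * b)\<^sup>2)" for d
  proof -
    let ?H = "H + d *\<^sub>R coord_matrix j"
    define c e where "c = 1 + d * a" and "e = d * b"
    define N where "N = c\<^sup>2 + e\<^sup>2"
    \<comment> \<open>\<open>p + iq = (H - is)\<^sup>-\<^sup>1 e\<^sub>j\<close>; the perturbed resolvent is \<open>(p + iq) / (c + ie)\<close>.\<close>
    define q' p' where "q' = (1 / N) *\<^sub>R (c *\<^sub>R q - e *\<^sub>R p)" and "p' = (1 / N) *\<^sub>R (c *\<^sub>R p + e *\<^sub>R q)"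
    have "N \<noteq> 0"
      using q(2) by (auto simp: N_def c_def e_def b_def sum_power2_eq_zero_iff)
    have eq1: "d * (c * b - e * a) = e" and eq2: "c + d * (c * a + e * b) = N"
      by (simp_all add: c_def e_def N_def power2_eq_square algebra_simps)
    have sym: "transpose ?H = ?H"
      using assms(1) by (auto simp: transpose_def vec_eq_iff coord_matrix_def)
    have mult: "?H *v x = H *v x + (d * x $ j) *\<^sub>R ?e" for x
      by (simp add: matrix_vector_mult_add_rdistrib coord_matrix_mult flip: scaleR_matrix_vector_assoc)
    have "?H *v q' = (1 / N) *\<^sub>R (c *\<^sub>R (s *\<^sub>R p) - e *\<^sub>R (?e - s *\<^sub>R q) + (d * (c * b - e * a)) *\<^sub>R ?e)"
      unfolding mult
      by (simp add: q'_def matrix_vector_mult_scaleR matrix_vector_mult_diff_distrib Hq Hp a_def b_def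
          scaleR_right_distrib algebra_simps)
    also have "\<dots> = s *\<^sub>R p'"
      unfolding eq1 by (simp add: p'_def algebra_simps)
    finally have Hq': "?H *v q' = s *\<^sub>R p'" .
    have "?H *v p' = (1 / N) *\<^sub>R (c *\<^sub>R (?e - s *\<^sub>R q) + e *\<^sub>R (s *\<^sub>R p) + (d * (c * a + e * b)) *\<^sub>R ?e)"
      unfolding mult
      by (simp add: p'_def matrix_vector_mult_scaleR matrix_vector_right_distrib Hq Hp a_def b_def
          scaleR_right_distrib algebra_simps)
    also have "\<dots> = (1 / N) *\<^sub>R ((c + d * (c * a + e * b)) *\<^sub>R ?e) - s *\<^sub>R q'"
      by (simp add: q'_def algebra_simps)
    also have "\<dots> = ?e - s *\<^sub>R q'"
      unfolding eq2 using \<open>N \<noteq> 0\<close> by simp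
    finally have Hp': "?H *v p' = ?e - s *\<^sub>R q'" .
    have "?H *v (?H *v q') + s\<^sup>2 *\<^sub>R q' = s *\<^sub>R ?e"
      unfolding Hq' matrix_vector_mult_scaleR Hp' by (simp add: algebra_simps power2_eq_square)
    from resolvent_diag_eqI[OF sym \<open>s > 0\<close> this] have "resolvent_diag s ?H j = q' $ j" .
    also have "q' $ j = (c * b - e * a) / N"
      by (simp add: q'_def a_def b_def)
    also have "c * b - e * a = b"
      by (simp add: c_def e_def algebra_simps)
    finally show ?thesis
      by (simp add: N_def c_def e_def)
  qed
  with q(2) that show thesis
    unfolding b_def by blast
qed

section \<open>Spectral averaging\<close>

lemma nn_integral_cauchy:
  "(\<integral>\<^sup>+x. ennreal (1 / (1 + x\<^sup>2)) \<partial>lborel) = ennreal pi"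
proof -
  have "set_integrable lborel UNIV (\<lambda>x. inverse (1 + x\<^sup>2) :: real)"
    using integrable_inverse_1_plus_square by simp
  then have int: "integrable lborel (\<lambda>x. inverse (1 + x\<^sup>2) :: real)"
    by (simp add: set_integrable_def)
  have "(\<integral>x. inverse (1 + x\<^sup>2) \<partial>lborel) = pi"
    using LBINT_inverse_1_plus_square
    by (simp add: interval_lebesgue_integral_def set_lebesgue_integral_def)
  then show ?thesis
    using nn_integral_eq_integral[OF int] by (simp add: inverse_eq_divide)
qed

text \<open>As a function of d the entry is a rescaled and shifted Cauchy density times pi, so the
  integral depends neither on \<open>H\<close> nor on \<open>s\<close>.\<close>

lemma nn_integral_resolvent_diag:
  fixes H :: "real^'n^'n"
  assumes "transpose H = H" "s > 0"
  shows "(\<integral>\<^sup>+d. ennreal (resolvent_diag s (H + d *\<^sub>R coord_matrix j) j) \<partial>lborel) = ennreal pi"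
proof -
  from resolvent_diag_rank_one[OF assms, where j = j] obtain a b where b: "b > 0" and
    eq: "\<And>d. resolvent_diag s (H + d *\<^sub>R coord_matrix j) j = b / ((1 + d * a)\<^sup>2 + (d * b)\<^sup>2)"
    by metis
  define N where "N = a\<^sup>2 + b\<^sup>2"
  have N: "N > 0"
    using b by (simp add: N_def add_nonneg_pos)
  \<comment> \<open>Completing the square, (1 + da)^2 + (db)^2 = N (d + a/N)^2 + b^2/N. The
    substitution d = -a/N + (b/N) u turns this into (b^2/N)(1 + u^2).\<close>
  have *: "b / N * (b / ((1 + (- (a / N) + b / N * u) * a)\<^sup>2 + ((- (a / N) + b / N * u) * b)\<^sup>2))
     = 1 / (1 + u\<^sup>2)" for u
  proof -
    have "N\<^sup>2 * ((1 + (- (a / N) + b / N * u) * a)\<^sup>2 + ((- (a / N) + b / N * u) * b)\<^sup>2)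
      = (N + (b * u - a) * a)\<^sup>2 + ((b * u - a) * b)\<^sup>2"
      using N by (simp add: power2_eq_square field_simps)
    also have "\<dots> = b\<^sup>2 * N * (1 + u\<^sup>2)"
      by (simp add: N_def power2_eq_square algebra_simps)
    also have "\<dots> = N\<^sup>2 * (b\<^sup>2 * (1 + u\<^sup>2) / N)"
      using N by (simp add: power2_eq_square)
    finally have "(1 + (- (a / N) + b / N * u) * a)\<^sup>2 + ((- (a / N) + b / N * u) * b)\<^sup>2
        = b\<^sup>2 * (1 + u\<^sup>2) / N"
      using N by (subst (asm) mult_left_cancel) auto
    then show ?thesis
      using N b by (simp add: power2_eq_square)
  qed
  have "(\<integral>\<^sup>+d. ennreal (resolvent_diag s (H + d *\<^sub>R coord_matrix j) j) \<partial>lborel)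
     = ennreal \<bar>b / N\<bar> * (\<integral>\<^sup>+u. ennreal (b / ((1 + (- (a / N) + b / N * u) * a)\<^sup>2
         + ((- (a / N) + b / N * u) * b)\<^sup>2)) \<partial>lborel)"
    unfolding eq using N b by (intro nn_integral_real_affine) auto
  also have "\<dots> = (\<integral>\<^sup>+u. ennreal (1 / (1 + u\<^sup>2)) \<partial>lborel)"
    using N b by (subst nn_integral_cmult[symmetric]) (auto simp flip: ennreal_mult' * intro!: nn_integral_cong)
  finally show ?thesis
    by (simp add: nn_integral_cauchy)
qed

section \<open>LU factorization from leading principal blocks\<close>

text \<open>Padding by the identity keeps the matrix type fixed for all k, while the determinant
  remains the leading principal minor and symmetry is preserved.\<close>

definition lead :: "'n::{finite,wellorder} \<Rightarrow> real^'n::{finite,wellorder}^'n::{finite,wellorder} \<Rightarrow> real^'n::{finite,wellorder}^'n::{finite,wellorder}" where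
  "lead k A = (\<chi> i j. if i \<le> k \<and> j \<le> k then A $ i $ j else if i = j then 1 else 0)"

text \<open>By Cramer's rule, the last column of the inverse of the leading block, padded with zeros.\<close>

definition lead_col :: "'n::{finite,wellorder} \<Rightarrow> real^'n::{finite,wellorder}^'n::{finite,wellorder} \<Rightarrow> real^'n::{finite,wellorder}" where
  "lead_col k A =
     (\<chi> j. det (\<chi> a b. if b = j then axis k 1 $ a else lead k A $ a $ b) / det (lead k A))"

lemma transpose_lead: "transpose A = A \<Longrightarrow> transpose (lead k A) = lead k A"
  by (auto simp: transpose_def lead_def vec_eq_iff)

lemma lead_mult_le:
  assumes "\<And>j. k < j \<Longrightarrow> y $ j = 0" "i \<le> k"
  shows "(lead k A *v y) $ i = (A *v y) $ i"
  unfolding matrix_vector_mult_def lead_def using assms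
  by (auto intro!: sum.cong simp: not_le)

lemma lead_mult_gt:
  assumes "k < i"
  shows "(lead k A *v y) $ i = y $ i"
  using assms
  by (simp add: not_le[symmetric] matrix_vector_mult_def lead_def if_distribR if_distrib[of "\<lambda>c. c * _"] cong: if_cong)

lemma lead_col_mult:
  assumes "det (lead k A) \<noteq> 0"
  shows "lead k A *v lead_col k A = axis k 1"
  unfolding cramer[OF assms] lead_col_def ..

lemma lead_col_eq_0:
  assumes "det (lead k A) \<noteq> 0" "k < j"
  shows "lead_col k A $ j = 0"
  using lead_mult_gt[OF assms(2), of A "lead_col k A"] assms(2)
  by (auto simp: lead_col_mult[OF assms(1)] axis_def split: if_splits)

text \<open>This makes the matrix with columns \<open>A *v lead_col k A\<close> unit lower
  triangular.\<close>

lemma mult_lead_col_le: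
  assumes "det (lead k A) \<noteq> 0" "i \<le> k"
  shows "(A *v lead_col k A) $ i = (if i = k then 1 else 0)"
  using lead_mult_le[OF lead_col_eq_0[OF assms(1)] assms(2), of A]
  by (simp add: lead_col_mult[OF assms(1)] axis_def)

section \<open>Existence and uniqueness of the factorization\<close>

lemma upper_triangular_mult:
  assumes "upper_triangular A" "upper_triangular B"
  shows "upper_triangular (A ** B)"
  unfolding upper_triangular_def matrix_matrix_mult_def
proof (intro allI impI)
  fix i j :: 'a
  assume "j < i"
  have "A $ i $ k * B $ k $ j = 0" for k
    using assms \<open>j < i\<close> unfolding upper_triangular_def
    by (metis le_less_trans linorder_not_less mult_eq_0_iff)
  then show "(\<chi> i j. \<Sum>k\<in>UNIV. A $ i $ k * B $ k $ j) $ i $ j = 0"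
    by (simp only: vec_lambda_beta sum.neutral_const)
qed

text \<open>Forward substitution by rows. For i <= k, the terms with j < i vanish by induction, as j
  < k, and those with j > i vanish because \<open>L\<close> is lower triangular; so W_ik =
  L'_ik.\<close>

lemma unit_lower_upper_cancel:
  fixes L L' W :: "real^'n::{finite,wellorder}^'n::{finite,wellorder}"
  assumes "lower_triangular L" "\<And>i. L $ i $ i = 1" "lower_triangular L'" "\<And>i. L' $ i $ i = 1"
    and "upper_triangular W" "L ** W = L'"
  shows "W = mat 1"
proof -
  have "i \<le> k \<Longrightarrow> W $ i $ k = (if i = k then 1 else 0)" for i k
  proof (induction i rule: less_induct)
    case (less i)
    have "L' $ i $ k = (\<Sum>j\<in>UNIV. L $ i $ j * W $ j $ k)"
      by (simp add: assms(6)[symmetric] matrix_matrix_mult_def)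
    also have "\<dots> = (\<Sum>j\<in>UNIV. if j = i then W $ i $ k else 0)"
    proof (rule sum.cong)
      fix j
      consider "j < i" | "j = i" | "i < j" by force
      then show "L $ i $ j * W $ j $ k = (if j = i then W $ i $ k else 0)"
      proof cases
        case 1
        then show ?thesis using less by auto
      next
        case 2
        then show ?thesis by (simp add: assms(2))
      next
        case 3
        then show ?thesis using assms(1) by (simp add: lower_triangular_def)
      qed
    qed simp
    also have "\<dots> = W $ i $ k" by simp
    finally show ?case
      using assms(3,4) less.prems by (auto simp: lower_triangular_def)
  qed
  moreover have "k < i \<Longrightarrow> W $ i $ k = 0" for i k
    using assms(5) by (simp add: upper_triangular_def)
  ultimately have "W $ i $ k = (if i = k then 1 else 0)" for i k
    by (metis linorder_not_less less_irrefl)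
  then show ?thesis
    by (simp add: vec_eq_iff mat_def)
qed

text \<open>The columns \<open>lead_col k A\<close> form an upper triangular V, and L = AV is unit
  lower triangular, so the candidate for U is the inverse of V. Symmetry of \<open>A\<close> gives a
  short proof that this inverse is upper triangular.\<close>

lemma LU_factorization_lead_col:
  fixes A :: "real^'n::{finite,wellorder}^'n::{finite,wellorder}"
  assumes sym: "transpose A = A" and nz: "\<And>k. det (lead k A) \<noteq> 0"
  obtains U where "\<And>F. LU_factorization A F \<longleftrightarrow> F = ((\<chi> i k. (A *v lead_col k A) $ i), U)"
proof -
  define V :: "real^'n::{finite,wellorder}^'n::{finite,wellorder}" where "V = (\<chi> j k. lead_col k A $ j)"
  define L where "L = A ** V"
  have L_nth: "L $ i $ k = (A *v lead_col k A) $ i" for i k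
    by (simp add: L_def V_def matrix_matrix_mult_def matrix_vector_mult_def)
  have L_lower: "lower_triangular L" and L_diag: "\<And>i. L $ i $ i = 1"
    by (auto simp: lower_triangular_def L_nth mult_lead_col_le[OF nz])
  have V_upper: "upper_triangular V"
    by (simp add: upper_triangular_def V_def lead_col_eq_0[OF nz])
  have "det L = 1"
    using L_lower by (subst det_lowerdiagonal) (auto simp: lower_triangular_def L_diag)
  then have "det V \<noteq> 0"
    by (auto simp: L_def det_mul)
  then obtain U where U: "U ** V = mat 1" "V ** U = mat 1"
    by (metis invertible_det_nz invertible_def)
  \<comment> \<open>This is V^T A V. It is symmetric, and as a product of two upper triangular
    matrices also upper triangular, hence diagonal. Then U = Delta^-1 L^T is upper
    triangular.\<close>
  define \<Delta> where "\<Delta> = transpose L ** V"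
  have "upper_triangular \<Delta>"
    unfolding \<Delta>_def using L_lower V_upper
    by (intro upper_triangular_mult) (auto simp: upper_triangular_def lower_triangular_def transpose_def)
  then have low: "\<Delta> $ i $ j = 0" if "j < i" for i j
    using that by (simp add: upper_triangular_def)
  have "transpose \<Delta> = \<Delta>"
    unfolding \<Delta>_def L_def by (simp add: matrix_transpose_mul sym matrix_mul_assoc)
  then have sym: "\<Delta> $ i $ j = \<Delta> $ j $ i" for i j
    by (simp add: transpose_def vec_eq_iff)
  have \<Delta>_off: "\<Delta> $ i $ j = 0" if "i \<noteq> j" for i j
    using that low[of i j] low[of j i] sym[of i j] by (cases i j rule: linorder_cases) simp_all
  have "det \<Delta> \<noteq> 0"
    using \<open>det V \<noteq> 0\<close> \<open>det L = 1\<close> by (simp add: \<Delta>_def det_mul)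
  then have \<Delta>_nz: "\<Delta> $ i $ i \<noteq> 0" for i
    using det_diagonal[OF \<Delta>_off] by auto
  have LT: "transpose L = \<Delta> ** U"
    by (simp add: \<Delta>_def U(2) flip: matrix_mul_assoc)
  have "(\<Delta> ** U) $ i $ j = \<Delta> $ i $ i * U $ i $ j" for i j
  proof -
    have "(\<Delta> ** U) $ i $ j = (\<Sum>k\<in>UNIV. if k = i then \<Delta> $ i $ i * U $ i $ j else 0)"
      unfolding matrix_matrix_mult_def vec_lambda_beta
      by (intro sum.cong refl) (metis \<Delta>_off mult_zero_left)
    then show ?thesis by simp
  qed
  then have LU: "\<Delta> $ i $ i * U $ i $ j = L $ j $ i" for i j
    unfolding LT[symmetric] by (simp add: transpose_def)
  have U_upper: "upper_triangular U"
    unfolding upper_triangular_def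
  proof (intro allI impI)
    fix i j :: 'n
    assume "j < i"
    then show "U $ i $ j = 0"
      using LU[of i j] L_lower \<Delta>_nz[of i] by (simp add: lower_triangular_def)
  qed
  have A_eq: "A = L ** U"
    by (simp add: L_def U(2) flip: matrix_mul_assoc)
  have "LU_factorization A F \<longleftrightarrow> F = (L, U)" for F
  proof
    assume "LU_factorization A F"
    then obtain L' U' where F: "F = (L', U')" "lower_triangular L'" "\<And>i. L' $ i $ i = 1"
      "upper_triangular U'" "A = L' ** U'"
      by (cases F) (auto simp: LU_factorization_def)
    \<comment> \<open>For any other factorization, L'U'V = AV = L, so U'V is an upper triangular
      matrix between two unit lower triangular ones and must be the identity.\<close>
    have W: "L' ** (U' ** V) = L"
      by (simp add: L_def F(5) matrix_mul_assoc)
    have "U' ** V = mat 1"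
      using unit_lower_upper_cancel[OF F(2,3) L_lower L_diag upper_triangular_mult[OF F(4) V_upper] W] .
    moreover from this have "U' = U"
      by (metis U(2) matrix_mul_assoc matrix_mul_lid matrix_mul_rid)
    ultimately show "F = (L, U)"
      using W F(1) by simp
  next
    assume "F = (L, U)"
    then show "LU_factorization A F"
      using L_lower L_diag U_upper A_eq by (simp add: LU_factorization_def)
  qed
  moreover have "L = (\<chi> i k. (A *v lead_col k A) $ i)"
    by (simp add: vec_eq_iff L_nth)
  ultimately show thesis
    using that by blast
qed

lemma growth_L_le:
  fixes A :: "real^'n::{finite,wellorder}^'n::{finite,wellorder}"
  assumes sym: "transpose A = A" and nz: "\<And>k. det (lead k A) \<noteq> 0"
    and le: "\<And>i k. k < i \<Longrightarrow> \<bar>(A *v lead_col k A) $ i\<bar> \<le> t" and "t \<ge> 0"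
  shows "growth_L A \<le> ereal (1 + real CARD('n) * t)"
proof -
  define L where "L = (\<chi> i k. (A *v lead_col k A) $ i)"
  obtain U where U: "\<And>F. LU_factorization A F \<longleftrightarrow> F = (L, U)"
    using LU_factorization_lead_col[OF sym nz] unfolding L_def by blast
  then have "(THE F. LU_factorization A F) = (L, U)" "\<exists>!F. LU_factorization A F"
    by auto
  then have "growth_L A = ereal (row_sum_norm L)"
    by (simp add: growth_L_def)
  moreover have "(\<Sum>k\<in>UNIV. \<bar>L $ i $ k\<bar>) \<le> 1 + real CARD('n) * t" for i
  proof -
    \<comment> \<open>The summand t is charged to every column, also on and above the diagonal, to
      get the simple bound 1 + nt.\<close>
    have "(\<Sum>k\<in>UNIV. \<bar>L $ i $ k\<bar>) \<le> (\<Sum>k\<in>UNIV. (if k = i then 1 else 0) + t)"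
    proof (rule sum_mono)
      fix k
      consider "k < i" | "k = i" | "i < k" by force
      then show "\<bar>L $ i $ k\<bar> \<le> (if k = i then 1 else 0) + t"
        by cases (use le[of k i] mult_lead_col_le[OF nz, of i k] \<open>t \<ge> 0\<close> in \<open>auto simp: L_def\<close>)
    qed
    then show ?thesis
      by (simp add: sum.distrib)
  qed
  ultimately show ?thesis
    by (auto simp: row_sum_norm_def)
qed

text \<open>
  If the leading block is singular, a kernel vector supported in \<open>{..k}\<close> shows that the sum is
  at least \<open>1 / s\<close>, so the singular case needs no separate treatment.
\<close>

lemma lead_resolvent_bound:
  fixes A :: "real^'n::{finite,wellorder}^'n::{finite,wellorder}" and k :: 'n
  assumes "transpose A = A" "s > 0"
  defines "Q \<equiv> s * (\<Sum>j\<in>{..k}. resolvent_diag s (lead k A) j)"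
  shows "det (lead k A) = 0 \<Longrightarrow> 1 \<le> 2 * Q"
    and "det (lead k A) \<noteq> 0 \<Longrightarrow> min 1 (s\<^sup>2 * (norm (lead_col k A))\<^sup>2) \<le> 2 * Q"
proof -
  note sym = transpose_lead[OF assms(1), of k]
  have bound: "s\<^sup>2 * (norm y)\<^sup>2 \<le> Q * ((norm (lead k A *v y))\<^sup>2 + s\<^sup>2 * (norm y)\<^sup>2)"
    if "\<And>j. k < j \<Longrightarrow> y $ j = 0" for y
    using mult_left_mono[OF norm_sq_le_sum_resolvent_diag[OF sym assms(2), of "{..k}" y], of s] that \<open>s > 0\<close>
    by (auto simp: Q_def power2_eq_square[of s] mult_ac not_le)
  have "Q \<ge> 0"
    unfolding Q_def using \<open>s > 0\<close> resolvent_diag_pos[OF sym assms(2)]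
    by (intro mult_nonneg_nonneg sum_nonneg) (auto intro: less_imp_le)
  show "1 \<le> 2 * Q" if "det (lead k A) = 0"
  proof -
    have "\<not> (\<exists>B. B ** lead k A = mat 1)"
      using that invertible_det_nz invertible_left_inverse by blast
    then obtain y where y: "lead k A *v y = 0" "y \<noteq> 0"
      unfolding matrix_left_invertible_ker by blast
    have "y $ j = 0" if "k < j" for j
      using lead_mult_gt[OF that, of A y] y(1) by simp
    from bound[OF this] y have "s\<^sup>2 * (norm y)\<^sup>2 * 1 \<le> s\<^sup>2 * (norm y)\<^sup>2 * Q"
      by (simp add: mult_ac)
    moreover have "s\<^sup>2 * (norm y)\<^sup>2 > 0"
      using y(2) \<open>s > 0\<close> by simp
    ultimately have "1 \<le> Q"
      using mult_le_cancel_left_pos by blast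
    then show ?thesis by simp
  qed
  show "min 1 (s\<^sup>2 * (norm (lead_col k A))\<^sup>2) \<le> 2 * Q" if nz: "det (lead k A) \<noteq> 0"
  proof -
    define w where "w = s\<^sup>2 * (norm (lead_col k A))\<^sup>2"
    \<comment> \<open>The block sends \<open>lead_col k A\<close> to a unit vector, so the first
      term in \<open>bound\<close> is 1. If w <= 1 then 1 + w <= 2 gives w <= 2Q; if w > 1 then 1 +
      w <= 2w gives 1 <= 2Q.\<close>
    have "w \<le> Q * (1 + w)"
      using bound[OF lead_col_eq_0[OF nz]] by (simp add: lead_col_mult[OF nz] w_def)
    moreover have "w \<ge> 0" by (simp add: w_def)
    ultimately show ?thesis
    proof (cases "w \<le> 1")
      case True
      then have "Q * (1 + w) \<le> Q * 2"
        using \<open>Q \<ge> 0\<close> by (intro mult_left_mono) auto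
      with True \<open>w \<le> Q * (1 + w)\<close> show ?thesis
        by (simp add: w_def[symmetric])
    next
      case False
      then have "Q * (1 + w) \<le> Q * (2 * w)"
        using \<open>Q \<ge> 0\<close> by (intro mult_left_mono) auto
      with \<open>w \<le> Q * (1 + w)\<close> have "w * 1 \<le> w * (2 * Q)"
        by (simp add: mult_ac)
      with False have "1 \<le> 2 * Q"
        by (subst (asm) mult_le_cancel_left_pos) auto
      with False show ?thesis
        by (simp add: w_def[symmetric])
    qed
  qed
qed

section \<open>Gaussian estimates\<close>

abbreviation gauss :: "real \<Rightarrow> real measure" where
  "gauss \<sigma> \<equiv> density lborel (normal_density 0 \<sigma>)"

lemma product_prob_space_gauss: "product_prob_space (\<lambda>_. gauss \<sigma>)"
  if "\<sigma> \<noteq> 0"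
proof -
  \<comment> \<open>The parameter may be negative; passing to its absolute value gives a genuine
    standard deviation.\<close>
  have "normal_density 0 \<sigma> = normal_density 0 \<bar>\<sigma>\<bar>"
    by (simp add: normal_density_def fun_eq_iff)
  then have "prob_space (gauss \<sigma>)"
    using prob_space_normal_density[of "\<bar>\<sigma>\<bar>" 0] that by simp
  then show ?thesis
    by (intro product_prob_spaceI)
qed

text \<open>The density is at most its peak value. This trades the Gaussian for Lebesgue measure,
  where spectral averaging is exact.\<close>

lemma nn_integral_gauss_le:
  assumes [measurable]: "f \<in> borel_measurable borel"
  shows "(\<integral>\<^sup>+x. f x \<partial>gauss \<sigma>) \<le> ennreal (1 / sqrt (2 * pi * \<sigma>\<^sup>2)) * (\<integral>\<^sup>+x. f x \<partial>lborel)"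
proof -
  have "normal_density 0 \<sigma> x \<le> 1 / sqrt (2 * pi * \<sigma>\<^sup>2) * 1" for x
    unfolding normal_density_def by (intro mult_left_mono) auto
  then have "(\<integral>\<^sup>+x. f x \<partial>gauss \<sigma>) \<le> (\<integral>\<^sup>+x. ennreal (1 / sqrt (2 * pi * \<sigma>\<^sup>2)) * f x \<partial>lborel)"
    by (subst nn_integral_density) (auto intro!: nn_integral_mono mult_right_mono ennreal_leI)
  then show ?thesis
    by (subst (asm) nn_integral_cmult) auto
qed

lemma nn_integral_gauss_affine_sq:
  assumes "\<sigma> \<noteq> 0"
  shows "(\<integral>\<^sup>+x. ennreal ((b + c * x)\<^sup>2) \<partial>gauss \<sigma>) = ennreal (b\<^sup>2 + c\<^sup>2 * \<sigma>\<^sup>2)"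
proof -
  let ?N = "normal_density 0 \<bar>\<sigma>\<bar>"
  have pos: "0 < \<bar>\<sigma>\<bar>" using assms by simp
  have N: "normal_density 0 \<sigma> = ?N"
    by (simp add: normal_density_def fun_eq_iff)
  \<comment> \<open>Expansion of the square: \<open>normal_moment_even\<close> at exponents 2 * 0
    and 2 * 1 supplies the moments of order 0 and 2, and the first moment vanishes.\<close>
  have "has_bochner_integral lborel (\<lambda>x. b\<^sup>2 * (?N x * (x - 0) ^ (2 * 0)) + 2 * b * c * (?N x * x)
      + c\<^sup>2 * (?N x * (x - 0) ^ (2 * 1)))
    (b\<^sup>2 * (fact (2 * 0) / ((2 / \<bar>\<sigma>\<bar>\<^sup>2) ^ 0 * fact 0)) + 2 * b * c * 0
      + c\<^sup>2 * (fact (2 * 1) / ((2 / \<bar>\<sigma>\<bar>\<^sup>2) ^ 1 * fact 1)))"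
    by (intro has_bochner_integral_add has_bochner_integral_mult_right normal_moment_even
        normal_moment_nz_1 pos)
  then have "has_bochner_integral lborel (\<lambda>x. ?N x * (b + c * x)\<^sup>2) (b\<^sup>2 + c\<^sup>2 * \<sigma>\<^sup>2)"
    by (simp add: power2_eq_square algebra_simps)
  then have "(\<integral>\<^sup>+x. ennreal (?N x * (b + c * x)\<^sup>2) \<partial>lborel) = ennreal (b\<^sup>2 + c\<^sup>2 * \<sigma>\<^sup>2)"
    by (simp add: has_bochner_integral_iff nn_integral_eq_integral)
  then show ?thesis
    unfolding N by (subst nn_integral_density) (auto simp: ennreal_mult)
qed

lemma measurable_gauss_coordinate:
  "p \<in> J \<Longrightarrow> (\<lambda>X. X p) \<in> borel_measurable (Pi\<^sub>M J (\<lambda>_. gauss \<sigma>))"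
  using measurable_component_singleton[of p J "\<lambda>_. gauss \<sigma>"] by simp

text \<open>Outside \<open>J\<close> the points of the product space take the constant value
  \<open>undefined\<close>, so evaluation is measurable at every index and membership need not be
  tracked.\<close>

lemma measurable_gauss_apply:
  "(\<lambda>X. X p) \<in> borel_measurable (Pi\<^sub>M J (\<lambda>_. gauss \<sigma>))"
proof (cases "p \<in> J")
  case True
  then show ?thesis
    by (rule measurable_gauss_coordinate)
next
  case False
  have "X p = undefined" if "X \<in> space (Pi\<^sub>M J (\<lambda>_. gauss \<sigma>))" for X
    using that False unfolding space_PiM by (rule PiE_arb)
  then show ?thesis
    by (subst measurable_cong[where g = "\<lambda>_. undefined"]) auto
qed

text \<open>Coordinates are integrated out one at a time; the remaining ones act as part of the
  offset, and centring removes the cross terms.\<close>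

lemma nn_integral_PiM_gauss_affine_sq:
  assumes "finite I" "\<sigma> \<noteq> 0"
  shows "(\<integral>\<^sup>+X. ennreal ((b + (\<Sum>p\<in>I. c p * X p))\<^sup>2) \<partial>Pi\<^sub>M I (\<lambda>_. gauss \<sigma>))
     = ennreal (b\<^sup>2 + \<sigma>\<^sup>2 * (\<Sum>p\<in>I. (c p)\<^sup>2))"
  using assms(1)
proof (induction I)
  interpret product_prob_space "\<lambda>_::'a. gauss \<sigma>"
    using product_prob_space_gauss[OF assms(2)] .
  case empty
  show ?case
    by (simp add: PiM_empty nn_integral_count_space_finite)
next
  interpret product_prob_space "\<lambda>_::'a. gauss \<sigma>"
    using product_prob_space_gauss[OF assms(2)] .
  case (insert i I)
  interpret I: prob_space "Pi\<^sub>M I (\<lambda>_. gauss \<sigma>)"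
    by (rule prob_space_PiM) (rule prob_space)
  note [measurable] = measurable_gauss_coordinate
  have "(\<integral>\<^sup>+X. ennreal ((b + (\<Sum>p\<in>insert i I. c p * X p))\<^sup>2) \<partial>Pi\<^sub>M (insert i I) (\<lambda>_. gauss \<sigma>))
     = (\<integral>\<^sup>+X. (\<integral>\<^sup>+y. ennreal ((b + (\<Sum>p\<in>insert i I. c p * (X(i := y)) p))\<^sup>2) \<partial>gauss \<sigma>) \<partial>Pi\<^sub>M I (\<lambda>_. gauss \<sigma>))"
    by (rule product_nn_integral_insert) (use insert in measurable)
  also have "\<dots> = (\<integral>\<^sup>+X. (\<integral>\<^sup>+y. ennreal (((b + (\<Sum>p\<in>I. c p * X p)) + c i * y)\<^sup>2) \<partial>gauss \<sigma>) \<partial>Pi\<^sub>M I (\<lambda>_. gauss \<sigma>))"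
  proof -
    have "(\<Sum>p\<in>insert i I. c p * (X(i := y)) p) = (\<Sum>p\<in>I. c p * X p) + c i * y" for X y
      using insert by (auto intro!: sum.cong)
    then show ?thesis by (simp add: add.assoc)
  qed
  also have "\<dots> = (\<integral>\<^sup>+X. ennreal ((b + (\<Sum>p\<in>I. c p * X p))\<^sup>2) + ennreal ((c i)\<^sup>2 * \<sigma>\<^sup>2) \<partial>Pi\<^sub>M I (\<lambda>_. gauss \<sigma>))"
    by (simp add: nn_integral_gauss_affine_sq[OF assms(2)])
  also have "\<dots> = ennreal (b\<^sup>2 + \<sigma>\<^sup>2 * (\<Sum>p\<in>I. (c p)\<^sup>2)) + ennreal ((c i)\<^sup>2 * \<sigma>\<^sup>2)"
    by (subst nn_integral_add) (auto simp: insert.IH I.emeasure_space_1)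
  also have "\<dots> = ennreal (b\<^sup>2 + \<sigma>\<^sup>2 * (\<Sum>p\<in>insert i I. (c p)\<^sup>2))"
    using insert by (subst ennreal_plus[symmetric]) (auto simp: algebra_simps intro!: add_nonneg_nonneg mult_nonneg_nonneg sum_nonneg)
  finally show ?case .
qed

section \<open>Measurability of the determinantal expressions\<close>

lemma borel_measurable_det:
  fixes F :: "'a \<Rightarrow> real^'n^'n"
  assumes [measurable]: "\<And>i j. (\<lambda>x. F x $ i $ j) \<in> borel_measurable P"
  shows "(\<lambda>x. det (F x)) \<in> borel_measurable P"
  unfolding det_def by measurable

lemma borel_measurable_resolvent_diag:
  fixes F :: "'a \<Rightarrow> real^'n^'n"
  assumes [measurable]: "\<And>i j. (\<lambda>x. F x $ i $ j) \<in> borel_measurable P"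
  shows "(\<lambda>x. resolvent_diag s (F x) j) \<in> borel_measurable P"
proof -
  have "(\<lambda>x. (F x ** F x + s\<^sup>2 *\<^sub>R mat 1) $ a $ b) \<in> borel_measurable P" for a b
    by (simp add: matrix_matrix_mult_def)
  then show ?thesis
    unfolding resolvent_diag_def
    by (intro borel_measurable_divide borel_measurable_det) (simp_all del: vector_add_component)
qed

lemma borel_measurable_lead:
  fixes F :: "'a \<Rightarrow> real^'n::{finite,wellorder}^'n::{finite,wellorder}"
  assumes [measurable]: "\<And>i j. (\<lambda>x. F x $ i $ j) \<in> borel_measurable P"
  shows "(\<lambda>x. lead k (F x) $ i $ j) \<in> borel_measurable P"
  by (simp add: lead_def)

lemma borel_measurable_lead_col:
  fixes F :: "'a \<Rightarrow> real^'n::{finite,wellorder}^'n::{finite,wellorder}"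
  assumes [measurable]: "\<And>i j. (\<lambda>x. F x $ i $ j) \<in> borel_measurable P"
  shows "(\<lambda>x. lead_col k (F x) $ j) \<in> borel_measurable P"
proof -
  note [measurable] = borel_measurable_lead[OF assms]
  show ?thesis
    unfolding lead_col_def vec_lambda_beta
    by (intro borel_measurable_divide borel_measurable_det) (auto intro: measurable_If)
qed

section \<open>A single column of the factor L\<close>

definition noise :: "('n \<times> 'n) set \<Rightarrow> ('n \<times> 'n \<Rightarrow> real) \<Rightarrow> real^'n^'n" where
  "noise J X = (\<chi> i j. if (i, j) \<in> J then X (i, j) else if (j, i) \<in> J then X (j, i) else 0)"

text \<open>
  \<open>J\<close> holds the positions on or below the diagonal that receive noise; the noise above the
  diagonal is its mirror image.
\<close>

locale perturbed_symmetric =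
  fixes Abar :: "real^'n::{finite,wellorder}^'n::{finite,wellorder}"
    and J :: "('n \<times> 'n) set" and \<sigma> :: real
  assumes symmetric: "transpose Abar = Abar"
    and onorm_le: "onorm ((*v) Abar) \<le> 1"
    and J_lower: "(i, j) \<in> J \<Longrightarrow> j \<le> i"
    and J_diag: "(i, i) \<in> J"
    and \<sigma>_nz: "\<sigma> \<noteq> 0" and \<sigma>_le: "\<sigma>\<^sup>2 \<le> 1"
begin

abbreviation "perturbed X \<equiv> Abar + noise J X"

abbreviation "gauss_PiM I \<equiv> Pi\<^sub>M I (\<lambda>_::'n \<times> 'n. gauss \<sigma>)"

lemma transpose_perturbed: "transpose (perturbed X) = perturbed X"
proof -
  have "noise J X $ i $ j = noise J X $ j $ i" for i j
    using J_lower[of i j] J_lower[of j i] by (auto simp: noise_def)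
  moreover have "Abar $ i $ j = Abar $ j $ i" for i j
    using symmetric by (simp add: transpose_def vec_eq_iff)
  ultimately show ?thesis
    by (simp add: transpose_def vec_eq_iff)
qed

lemma perturbed_measurable:
  assumes "\<And>p. p \<in> J \<Longrightarrow> (\<lambda>x. F x p) \<in> borel_measurable P"
  shows "(\<lambda>x. perturbed (F x) $ i $ j) \<in> borel_measurable P"
proof -
  have "(\<lambda>x. noise J (F x) $ i $ j) \<in> borel_measurable P"
    using assms unfolding noise_def vec_lambda_beta
    by (cases "(i, j) \<in> J"; cases "(j, i) \<in> J") auto
  then show ?thesis by simp
qed

text \<open>The source of the independence: the k-th block, and so its inverse, sees only the noise
  in rows up to k.\<close>

lemma lead_perturbed_cong:
  assumes "\<And>p. p \<in> J \<Longrightarrow> fst p \<le> k \<Longrightarrow> X p = Y p"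
  shows "lead k (perturbed X) = lead k (perturbed Y)"
  using assms by (auto simp: lead_def noise_def vec_eq_iff)

text \<open>Below the block no mirrored noise enters: for j <= k < i the position (j, i) lies above
  the diagonal, outside \<open>J\<close>. So the product is a linear form in the coordinates of row
  i.\<close>

lemma noise_mult_gt:
  assumes "\<And>j. k < j \<Longrightarrow> v $ j = 0" "k < i"
  shows "(noise J X *v v) $ i = (\<Sum>p\<in>J. (if fst p = i then v $ snd p else 0) * X p)"
proof -
  have "(noise J X *v v) $ i = (\<Sum>j\<in>UNIV. if (i, j) \<in> J then v $ j * X (i, j) else 0)"
    unfolding matrix_vector_mult_def vec_lambda_beta
  proof (intro sum.cong refl)
    fix j
    show "noise J X $ i $ j * v $ j = (if (i, j) \<in> J then v $ j * X (i, j) else 0)"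
    proof (cases "k < j")
      case False
      then have "(j, i) \<notin> J" using J_lower[of j i] assms(2) by auto
      then show ?thesis by (simp add: noise_def)
    qed (simp add: assms(1))
  qed
  also have "\<dots> = (\<Sum>p\<in>Pair i ` {j. (i, j) \<in> J}. v $ snd p * X p)"
    by (subst sum.reindex) (auto simp: inj_on_def sum.If_cases)
  also have "\<dots> = (\<Sum>p\<in>J. (if fst p = i then v $ snd p else 0) * X p)"
    by (rule sum.mono_neutral_cong_left) auto
  finally show ?thesis .
qed

lemma sum_noise_coeff_le:
  "(\<Sum>p\<in>J. (if fst p = i then v $ snd p else 0)\<^sup>2) \<le> (norm v)\<^sup>2"
proof -
  have "(\<Sum>p\<in>J. (if fst p = i then v $ snd p else 0)\<^sup>2)
     \<le> (\<Sum>p\<in>UNIV. (if fst p = i then v $ snd p else 0)\<^sup>2)"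
    by (rule sum_mono2) auto
  also have "\<dots> = (\<Sum>p\<in>range (Pair i). (v $ snd p)\<^sup>2)"
    by (rule sum.mono_neutral_cong_right) auto
  also have "\<dots> = (norm v)\<^sup>2"
    unfolding power2_norm_eq_inner inner_vec_def
    by (subst sum.reindex) (simp_all add: inj_on_def power2_eq_square)
  finally show ?thesis .
qed

text \<open>\<open>Y\<close> completes the integrated coordinates to a full noise assignment; it
  will be \<open>merge\<close> with the rows up to k held fixed. Each component is then a constant
  plus a centred Gaussian linear form of variance at most \<open>\<sigma>\<^sup>2\<close>
  |v|^2.\<close>

lemma nn_integral_below_block_le:
  assumes v: "\<And>j. k < j \<Longrightarrow> v $ j = 0" and "I \<subseteq> J" and I: "\<And>p. p \<in> J \<Longrightarrow> k < fst p \<Longrightarrow> p \<in> I"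
    and Y: "\<And>X p. p \<in> I \<Longrightarrow> Y X p = X p"
  shows "(\<integral>\<^sup>+X. ennreal (\<Sum>i\<in>{k<..}. ((perturbed (Y X) *v v) $ i)\<^sup>2) \<partial>gauss_PiM I)
     \<le> ennreal (real CARD('n) * (norm v)\<^sup>2)"
proof -
  define c where "c i p = (if fst p = i then v $ snd p else 0)" for i and p :: "'n \<times> 'n"
  note [measurable] = measurable_gauss_coordinate
  have eq: "(perturbed (Y X) *v v) $ i = (Abar *v v) $ i + (\<Sum>p\<in>I. c i p * X p)" if "k < i" for i X
  proof -
    have "(noise J (Y X) *v v) $ i = (\<Sum>p\<in>J. c i p * Y X p)"
      unfolding c_def by (rule noise_mult_gt[OF v that])
    also have "\<dots> = (\<Sum>p\<in>I. c i p * X p)"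
      using \<open>I \<subseteq> J\<close> I that by (intro sum.mono_neutral_cong_right) (auto simp: c_def Y)
    finally show ?thesis
      by (simp add: matrix_vector_mult_add_rdistrib)
  qed
  have coeff: "(\<Sum>p\<in>I. (c i p)\<^sup>2) \<le> (norm v)\<^sup>2" for i
    using sum_mono2[of J I "\<lambda>p. (c i p)\<^sup>2"] \<open>I \<subseteq> J\<close> sum_noise_coeff_le[of i v]
    by (auto simp: c_def intro: order_trans)
  have "(\<integral>\<^sup>+X. ennreal (\<Sum>i\<in>{k<..}. ((perturbed (Y X) *v v) $ i)\<^sup>2) \<partial>gauss_PiM I)
    = (\<integral>\<^sup>+X. (\<Sum>i\<in>{k<..}. ennreal (((Abar *v v) $ i + (\<Sum>p\<in>I. c i p * X p))\<^sup>2)) \<partial>gauss_PiM I)"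
    by (intro nn_integral_cong) (simp add: eq sum_nonneg)
  also have "\<dots> = (\<Sum>i\<in>{k<..}. (\<integral>\<^sup>+X. ennreal (((Abar *v v) $ i + (\<Sum>p\<in>I. c i p * X p))\<^sup>2) \<partial>gauss_PiM I))"
    by (rule nn_integral_sum) measurable
  also have "\<dots> = (\<Sum>i\<in>{k<..}. ennreal (((Abar *v v) $ i)\<^sup>2 + \<sigma>\<^sup>2 * (\<Sum>p\<in>I. (c i p)\<^sup>2)))"
    by (simp add: nn_integral_PiM_gauss_affine_sq[OF _ \<sigma>_nz])
  also have "\<dots> = ennreal (\<Sum>i\<in>{k<..}. ((Abar *v v) $ i)\<^sup>2 + \<sigma>\<^sup>2 * (\<Sum>p\<in>I. (c i p)\<^sup>2))"
    by (intro sum_ennreal add_nonneg_nonneg mult_nonneg_nonneg sum_nonneg) auto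
  also have "\<dots> \<le> ennreal (real CARD('n) * (norm v)\<^sup>2)"
  proof (rule ennreal_leI)
    \<comment> \<open>The index k itself is missing from the rows below; the spare unit absorbs the
      contribution |Abar v|^2 <= |v|^2.\<close>
    have "card {k<..} < CARD('n)"
      by (rule psubset_card_mono) auto
    then have card: "real (card {k<..}) + 1 \<le> real CARD('n)"
      by linarith
    have "norm (Abar *v v) \<le> onorm ((*v) Abar) * norm v"
      by (intro onorm matrix_vector_mul_bounded_linear)
    also have "\<dots> \<le> 1 * norm v"
      by (intro mult_right_mono onorm_le) auto
    finally have Av: "norm (Abar *v v) \<le> norm v" by simp
    have "(\<Sum>i\<in>{k<..}. ((Abar *v v) $ i)\<^sup>2) \<le> (\<Sum>i\<in>UNIV. ((Abar *v v) $ i)\<^sup>2)"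
      by (rule sum_mono2) auto
    also have "\<dots> = (norm (Abar *v v))\<^sup>2"
      by (simp add: power2_norm_eq_inner inner_vec_def) (simp add: power2_eq_square)
    also have "\<dots> \<le> (norm v)\<^sup>2"
      using Av by (intro power_mono) auto
    finally have 1: "(\<Sum>i\<in>{k<..}. ((Abar *v v) $ i)\<^sup>2) \<le> (norm v)\<^sup>2" .
    have "\<sigma>\<^sup>2 * (\<Sum>p\<in>I. (c i p)\<^sup>2) \<le> 1 * (norm v)\<^sup>2" for i
      by (intro mult_mono coeff \<sigma>_le sum_nonneg) auto
    then have "(\<Sum>i\<in>{k<..}. \<sigma>\<^sup>2 * (\<Sum>p\<in>I. (c i p)\<^sup>2)) \<le> real (card {k<..}) * (norm v)\<^sup>2"
      using sum_bounded_above[of "{k<..}" _ "(norm v)\<^sup>2"] by simp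
    with 1 have "(\<Sum>i\<in>{k<..}. ((Abar *v v) $ i)\<^sup>2 + \<sigma>\<^sup>2 * (\<Sum>p\<in>I. (c i p)\<^sup>2)) \<le> (real (card {k<..}) + 1) * (norm v)\<^sup>2"
      by (simp add: sum.distrib algebra_simps)
    also have "\<dots> \<le> real CARD('n) * (norm v)\<^sup>2"
      by (intro mult_right_mono card) auto
    finally show "(\<Sum>i\<in>{k<..}. ((Abar *v v) $ i)\<^sup>2 + \<sigma>\<^sup>2 * (\<Sum>p\<in>I. (c i p)\<^sup>2)) \<le> real CARD('n) * (norm v)\<^sup>2" .
  qed
  finally show ?thesis .
qed

text \<open>Every diagonal position carries its own independent noise. Integrating over that of (j,
  j) first, with all else fixed, gives a bound uniform in the other coordinates.\<close>

lemma nn_integral_resolvent_diag_le: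
  assumes "s > 0" "j \<le> k" and I: "\<And>p. p \<in> J \<Longrightarrow> fst p \<le> k \<Longrightarrow> p \<in> I"
  shows "(\<integral>\<^sup>+X. ennreal (resolvent_diag s (lead k (perturbed X)) j) \<partial>gauss_PiM I)
     \<le> ennreal (pi / sqrt (2 * pi * \<sigma>\<^sup>2))"
proof -
  interpret product_prob_space "\<lambda>_::'n \<times> 'n. gauss \<sigma>"
    using product_prob_space_gauss[OF \<sigma>_nz] .
  define I' where "I' = I - {(j, j)}"
  have I_eq: "I = insert (j, j) I'"
    using I[OF J_diag] \<open>j \<le> k\<close> by (auto simp: I'_def)
  interpret I': prob_space "gauss_PiM I'"
    by (rule prob_space_PiM) (rule prob_space)
  let ?f = "\<lambda>X. ennreal (resolvent_diag s (lead k (perturbed X)) j)"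
  have meas_f: "?f \<in> borel_measurable (gauss_PiM I)"
    by (intro measurable_compose[OF _ measurable_ennreal] borel_measurable_resolvent_diag
        borel_measurable_lead perturbed_measurable measurable_gauss_apply)
  have fin: "finite I'" "(j, j) \<notin> I'"
    by (auto simp: I'_def)
  \<comment> \<open>The base matrix has the noise at (j, j) switched off; since j <= k, restoring it
    changes just that diagonal entry of the block.\<close>
  define H where "H X = lead k (perturbed (X((j, j) := 0)))" for X
  have upd: "lead k (perturbed (X((j, j) := y))) = H X + y *\<^sub>R coord_matrix j" for X y
    unfolding H_def using \<open>j \<le> k\<close> J_diag by (auto simp: vec_eq_iff lead_def noise_def coord_matrix_def)
  have "(\<integral>\<^sup>+X. ?f X \<partial>gauss_PiM I)
    = (\<integral>\<^sup>+X. (\<integral>\<^sup>+y. ?f (X((j, j) := y)) \<partial>gauss \<sigma>) \<partial>gauss_PiM I')"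
    unfolding I_eq by (rule product_nn_integral_insert[OF fin meas_f[unfolded I_eq]])
  also have "\<dots> \<le> (\<integral>\<^sup>+X. ennreal (pi / sqrt (2 * pi * \<sigma>\<^sup>2)) \<partial>gauss_PiM I')"
  proof (rule nn_integral_mono)
    fix X
    have meas: "(\<lambda>y. ennreal (resolvent_diag s (H X + y *\<^sub>R coord_matrix j) j)) \<in> borel_measurable borel"
      by (intro measurable_compose[OF _ measurable_ennreal] borel_measurable_resolvent_diag) simp
    have "(\<integral>\<^sup>+y. ?f (X((j, j) := y)) \<partial>gauss \<sigma>)
      \<le> ennreal (1 / sqrt (2 * pi * \<sigma>\<^sup>2)) * (\<integral>\<^sup>+y. ennreal (resolvent_diag s (H X + y *\<^sub>R coord_matrix j) j) \<partial>lborel)"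
      unfolding upd by (rule nn_integral_gauss_le[OF meas])
    also have "\<dots> = ennreal (pi / sqrt (2 * pi * \<sigma>\<^sup>2))"
      by (simp add: nn_integral_resolvent_diag[OF _ \<open>s > 0\<close>] H_def
          transpose_lead[OF transpose_perturbed] flip: ennreal_mult')
    finally show "(\<integral>\<^sup>+y. ?f (X((j, j) := y)) \<partial>gauss \<sigma>) \<le> ennreal (pi / sqrt (2 * pi * \<sigma>\<^sup>2))" .
  qed
  also have "\<dots> = ennreal (pi / sqrt (2 * pi * \<sigma>\<^sup>2))"
    by (simp add: I'.emeasure_space_1)
  finally show ?thesis .
qed

text \<open>For t > 0 the second alternative says that column k of the factor has Euclidean norm
  above t below the diagonal. With singular blocks included, the factorization exists and is unique
  outside the union over k.\<close>

definition exceptional :: "'n \<Rightarrow> real \<Rightarrow> ('n \<times> 'n \<Rightarrow> real) set" where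
  "exceptional k t = {X. det (lead k (perturbed X)) = 0 \<or>
     t\<^sup>2 < (\<Sum>i\<in>{k<..}. ((perturbed X *v lead_col k (perturbed X)) $ i)\<^sup>2)}"

lemma exceptional_measurable:
  "exceptional k t \<inter> space (gauss_PiM J) \<in> sets (gauss_PiM J)"
proof -
  note coord = perturbed_measurable[OF measurable_gauss_apply[of _ J \<sigma>]]
  note [measurable] = coord borel_measurable_lead_col[OF coord]
    borel_measurable_det[OF borel_measurable_lead[OF coord]]
  have "{X \<in> space (gauss_PiM J). det (lead k (perturbed X)) = 0 \<or>
     t\<^sup>2 < (\<Sum>i\<in>{k<..}. (\<Sum>j\<in>UNIV. perturbed X $ i $ j * lead_col k (perturbed X) $ j)\<^sup>2)}
    \<in> sets (gauss_PiM J)"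
    by measurable
  also have "?this \<longleftrightarrow> ?thesis"
    by (rule arg_cong[where f = "\<lambda>S. S \<in> sets (gauss_PiM J)"])
      (auto simp: exceptional_def matrix_vector_mult_def)
  finally show ?thesis .
qed

text \<open>
  The noise in the rows up to \<open>k\<close> determines the \<open>k\<close>-th column of the inverse of the leading
  block; the rows below are independent of it, so Chebyshev's inequality applies conditionally.
\<close>

lemma emeasure_exceptional_le:
  assumes "t > 0"
  defines "s \<equiv> sqrt (real CARD('n)) / t"
  shows "emeasure (gauss_PiM J) (exceptional k t \<inter> space (gauss_PiM J))
     \<le> ennreal (2 * s * real CARD('n) * (pi / sqrt (2 * pi * \<sigma>\<^sup>2)))"
proof -
  interpret product_prob_space "\<lambda>_::'n \<times> 'n. gauss \<sigma>"
    using product_prob_space_gauss[OF \<sigma>_nz] .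
  have "s > 0" using assms by simp
  define J1 where "J1 = {p\<in>J. fst p \<le> k}"
  define J2 where "J2 = {p\<in>J. k < fst p}"
  have J: "J = J1 \<union> J2" and disj: "J1 \<inter> J2 = {}"
    by (auto simp: J1_def J2_def)
  interpret J2: prob_space "gauss_PiM J2"
    by (rule prob_space_PiM) (rule prob_space)
  let ?E = "exceptional k t \<inter> space (gauss_PiM J)"
  define r where "r j X = resolvent_diag s (lead k (perturbed X)) j" for j X
  have r_nonneg: "r j X \<ge> 0" for j X
    unfolding r_def using resolvent_diag_pos[OF transpose_lead[OF transpose_perturbed] \<open>s > 0\<close>]
    by (intro less_imp_le)
  have r_meas: "r j \<in> borel_measurable (gauss_PiM J1)" for j
    unfolding r_def
    by (intro borel_measurable_resolvent_diag borel_measurable_lead perturbed_measurable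
        measurable_gauss_apply)
  have inner: "(\<integral>\<^sup>+Y. indicator ?E (merge J1 J2 (X, Y)) \<partial>gauss_PiM J2)
      \<le> ennreal (2 * (s * (\<Sum>j\<in>{..k}. r j X)))" (is "?int \<le> _") for X
  proof -
    have lead_eq: "lead k (perturbed (merge J1 J2 (X, Y))) = lead k (perturbed X)" for Y
      by (rule lead_perturbed_cong) (simp add: J1_def merge_def)
    have col_eq: "lead_col k (perturbed (merge J1 J2 (X, Y))) = lead_col k (perturbed X)" for Y
      unfolding lead_col_def lead_eq ..
    note bound = lead_resolvent_bound[OF transpose_perturbed \<open>s > 0\<close>, of k X, folded r_def]
    have "?int \<le> (\<integral>\<^sup>+Y. 1 \<partial>gauss_PiM J2)"
      by (intro nn_integral_mono) (simp add: indicator_def)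
    then have le1: "?int \<le> 1"
      by (simp add: J2.emeasure_space_1)
    show ?thesis
    proof (cases "det (lead k (perturbed X)) = 0")
      case True
      from le1 show ?thesis
        using bound(1)[OF True] by (auto intro: order_trans simp flip: ennreal_1 intro!: ennreal_leI)
    next
      case False
      let ?v = "lead_col k (perturbed X)"
      \<comment> \<open>Chebyshev: the block is nonsingular here, so on the event the sum of squares
        exceeds t^2.\<close>
      have "?int \<le> (\<integral>\<^sup>+Y. ennreal (1 / t\<^sup>2) *
          ennreal (\<Sum>i\<in>{k<..}. ((perturbed (merge J1 J2 (X, Y)) *v ?v) $ i)\<^sup>2) \<partial>gauss_PiM J2)"
      proof (rule nn_integral_mono)
        fix Y
        let ?S = "\<Sum>i\<in>{k<..}. ((perturbed (merge J1 J2 (X, Y)) *v ?v) $ i)\<^sup>2"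
        have "1 \<le> 1 / t\<^sup>2 * ?S" if "merge J1 J2 (X, Y) \<in> ?E"
          using that False \<open>t > 0\<close> by (auto simp: exceptional_def lead_eq col_eq field_simps)
        then show "indicator ?E (merge J1 J2 (X, Y)) \<le> ennreal (1 / t\<^sup>2) * ennreal ?S"
          by (auto simp: indicator_def simp flip: ennreal_mult' ennreal_1 intro!: ennreal_leI)
      qed
      also have "\<dots> = ennreal (1 / t\<^sup>2) *
          (\<integral>\<^sup>+Y. ennreal (\<Sum>i\<in>{k<..}. ((perturbed (merge J1 J2 (X, Y)) *v ?v) $ i)\<^sup>2) \<partial>gauss_PiM J2)"
      proof (rule nn_integral_cmult)
        have "(\<lambda>Y. merge J1 J2 (X, Y) p) \<in> borel_measurable (gauss_PiM J2)" for p
          unfolding merge_def using measurable_gauss_apply[of p J2 \<sigma>]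
          by (cases "p \<in> J1"; cases "p \<in> J2") simp_all
        from perturbed_measurable[OF this]
        show "(\<lambda>Y. ennreal (\<Sum>i\<in>{k<..}. ((perturbed (merge J1 J2 (X, Y)) *v ?v) $ i)\<^sup>2))
            \<in> borel_measurable (gauss_PiM J2)"
          unfolding matrix_vector_mult_def vec_lambda_beta
          by (intro measurable_compose[OF _ measurable_ennreal] borel_measurable_sum
              borel_measurable_power borel_measurable_times borel_measurable_const)
      qed
      also have "\<dots> \<le> ennreal (1 / t\<^sup>2) * ennreal (real CARD('n) * (norm ?v)\<^sup>2)"
        using disj
        by (intro mult_left_mono nn_integral_below_block_le lead_col_eq_0[OF False])
          (auto simp: J2_def J1_def merge_def)
      \<comment> \<open>\<open>s\<close> is chosen so that n / t^2 = s^2. The trivial bound 1 is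
        kept alongside, since the resolvent sum controls only the truncation of this quantity at
        1.\<close>
      also have "\<dots> = ennreal (s\<^sup>2 * (norm ?v)\<^sup>2)"
        by (simp add: s_def power_divide flip: ennreal_mult')
      finally have "?int \<le> ennreal (min 1 (s\<^sup>2 * (norm ?v)\<^sup>2))"
        using le1 by (auto simp: min_def)
      also have "\<dots> \<le> ennreal (2 * (s * (\<Sum>j\<in>{..k}. r j X)))"
        by (intro ennreal_leI bound(2)[OF False])
      finally show ?thesis .
    qed
  qed
  have "emeasure (gauss_PiM J) ?E = (\<integral>\<^sup>+X. indicator ?E X \<partial>gauss_PiM J)"
    by (rule nn_integral_indicator[symmetric]) (rule exceptional_measurable)
  also have "\<dots> = (\<integral>\<^sup>+X. indicator ?E X \<partial>gauss_PiM (J1 \<union> J2))"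
    by (simp only: J[symmetric])
  also have "\<dots> = (\<integral>\<^sup>+X. (\<integral>\<^sup>+Y. indicator ?E (merge J1 J2 (X, Y)) \<partial>gauss_PiM J2) \<partial>gauss_PiM J1)"
    using exceptional_measurable
    by (intro product_nn_integral_fold disj) (auto simp flip: J)
  also have "\<dots> \<le> (\<integral>\<^sup>+X. ennreal (2 * (s * (\<Sum>j\<in>{..k}. r j X))) \<partial>gauss_PiM J1)"
    by (intro nn_integral_mono inner)
  also have "\<dots> = (\<integral>\<^sup>+X. ennreal (2 * s) * (\<Sum>j\<in>{..k}. ennreal (r j X)) \<partial>gauss_PiM J1)"
    using \<open>s > 0\<close> r_nonneg by (simp add: sum_nonneg mult.assoc flip: ennreal_mult')
  also have "\<dots> = ennreal (2 * s) * (\<Sum>j\<in>{..k}. \<integral>\<^sup>+X. ennreal (r j X) \<partial>gauss_PiM J1)"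
    using r_meas by (simp add: nn_integral_cmult nn_integral_sum)
  also have "\<dots> \<le> ennreal (2 * s) * (\<Sum>j\<in>{..k}. ennreal (pi / sqrt (2 * pi * \<sigma>\<^sup>2)))"
    unfolding r_def
    by (intro mult_left_mono sum_mono nn_integral_resolvent_diag_le \<open>s > 0\<close>) (auto simp: J1_def)
  also have "\<dots> \<le> ennreal (2 * s * (real (card {..k}) * (pi / sqrt (2 * pi * \<sigma>\<^sup>2))))"
    using \<open>s > 0\<close> by (simp add: ennreal_of_nat_eq_real_of_nat flip: ennreal_mult' ennreal_mult'')
  also have "\<dots> \<le> ennreal (2 * s * real CARD('n) * (pi / sqrt (2 * pi * \<sigma>\<^sup>2)))"
    unfolding mult.assoc using \<open>s > 0\<close>
    by (intro ennreal_leI mult_left_mono mult_right_mono) (auto intro!: card_mono)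
  finally show ?thesis .
qed

text \<open>Union bound over the n columns. One factor n counts columns, one counts diagonal
  entries, and sqrt n comes from the second moment; 2 pi / sqrt (2 pi sigma^2) simplifies to sqrt (2
  pi) / |sigma|.\<close>

lemma emeasure_Union_exceptional_le:
  assumes "t > 0"
  shows "emeasure (gauss_PiM J) ((\<Union>k. exceptional k t) \<inter> space (gauss_PiM J))
     \<le> ennreal (sqrt (2 * pi) * real CARD('n) ^ 2 * sqrt (real CARD('n)) / (t * \<bar>\<sigma>\<bar>))"
proof -
  let ?n = "real CARD('n)"
  have "emeasure (gauss_PiM J) (\<Union>k\<in>UNIV. exceptional k t \<inter> space (gauss_PiM J))
    \<le> (\<Sum>k\<in>UNIV. emeasure (gauss_PiM J) (exceptional k t \<inter> space (gauss_PiM J)))"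
    by (rule emeasure_subadditive_finite) (auto intro: exceptional_measurable)
  also have "\<dots> \<le> (\<Sum>k\<in>(UNIV :: 'n set). ennreal (2 * (sqrt ?n / t) * ?n * (pi / sqrt (2 * pi * \<sigma>\<^sup>2))))"
    by (intro sum_mono emeasure_exceptional_le assms)
  also have "\<dots> = ennreal (?n * (2 * (sqrt ?n / t) * ?n * (pi / sqrt (2 * pi * \<sigma>\<^sup>2))))"
    by (simp add: ennreal_of_nat_eq_real_of_nat flip: ennreal_mult')
  also have "?n * (2 * (sqrt ?n / t) * ?n * (pi / sqrt (2 * pi * \<sigma>\<^sup>2))) = sqrt (2 * pi) * ?n ^ 2 * sqrt ?n / (t * \<bar>\<sigma>\<bar>)"
  proof -
    have "2 * pi / sqrt (2 * pi * \<sigma>\<^sup>2) = sqrt (2 * pi) / \<bar>\<sigma>\<bar>"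
      by (simp only: real_sqrt_mult[of "2 * pi"] real_sqrt_abs) (simp add: divide_simps)
    moreover have "?n * (2 * (sqrt ?n / t) * ?n * (pi / sqrt (2 * pi * \<sigma>\<^sup>2)))
        = ?n ^ 2 * sqrt ?n / t * (2 * pi / sqrt (2 * pi * \<sigma>\<^sup>2))"
      by (simp add: power2_eq_square)
    ultimately show ?thesis
      by simp
  qed
  finally show ?thesis
    by (simp add: Int_UN_distrib2 Int_commute)
qed

lemma growth_L_le_outside_exceptional:
  assumes "t \<ge> 0" "X \<notin> (\<Union>k. exceptional k t)"
  shows "growth_L (perturbed X) \<le> ereal (1 + real CARD('n) * t)"
proof (rule growth_L_le[OF transpose_perturbed])
  let ?A = "perturbed X"
  show "det (lead k ?A) \<noteq> 0" for k
    using assms(2) by (auto simp: exceptional_def)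
  show "\<bar>(?A *v lead_col k ?A) $ i\<bar> \<le> t" if "k < i" for i k
  proof (rule abs_le_square_iff[THEN iffD2, of _ t, simplified abs_of_nonneg[OF assms(1)]])
    have "((?A *v lead_col k ?A) $ i)\<^sup>2 \<le> (\<Sum>i\<in>{k<..}. ((?A *v lead_col k ?A) $ i)\<^sup>2)"
      using that by (intro member_le_sum) auto
    also have "\<dots> \<le> t\<^sup>2"
      using assms(2) by (auto simp: exceptional_def not_less)
    finally show "((?A *v lead_col k ?A) $ i)\<^sup>2 \<le> t\<^sup>2" .
  qed
qed (fact assms(1))

end

section \<open>The random matrix\<close>

text \<open>Merges three independence assumptions into one family: within the off-diagonal noise,
  within the diagonal, and between the two matrices. On \<open>J\<close> the noise is recovered from
  \<open>T\<close> by subtracting \<open>C\<close>, so events about it are events about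
  \<open>T\<close>, and the product formula factors in two stages.\<close>

lemma (in prob_space) indep_vars_offdiag_diag:
  fixes T D :: "'a \<Rightarrow> real^'n^'n" and G :: "'n \<times> 'n \<Rightarrow> 'a \<Rightarrow> real"
  assumes offdiag: "\<And>i. (i, i) \<notin> J"
    and G: "indep_vars (\<lambda>_. borel) G J"
    and G_eq: "\<And>i j \<omega>. (i, j) \<in> J \<Longrightarrow> \<omega> \<in> space M \<Longrightarrow> G (i, j) \<omega> = T \<omega> $ i $ j - C $ i $ j"
    and D: "indep_vars (\<lambda>_. borel) (\<lambda>i \<omega>. D \<omega> $ i $ i) UNIV"
    and TD: "indep_var borel T borel D"
  shows "indep_vars (\<lambda>_. borel) (\<lambda>p \<omega>. if p \<in> J then G p \<omega> else D \<omega> $ fst p $ fst p)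
    (J \<union> range (\<lambda>i. (i, i)))"
    (is "indep_vars _ ?X (J \<union> ?I)")
proof (subst indep_vars_finite[where E = "\<lambda>_. sets borel"])
  have disj: "J \<inter> ?I = {}" using offdiag by auto
  show "random_variable borel (?X p)" if "p \<in> J \<union> ?I" for p
    using that G D disj by (cases "p \<in> J") (auto simp: indep_vars_def)
  show "\<forall>A\<in>J \<union> ?I \<rightarrow> sets borel. prob (\<Inter>p\<in>J \<union> ?I. ?X p -` A p \<inter> space M)
      = (\<Prod>p\<in>J \<union> ?I. prob (?X p -` A p \<inter> space M))"
  proof
    fix A :: "'n \<times> 'n \<Rightarrow> real set"
    assume "A \<in> J \<union> ?I \<rightarrow> sets borel"
    then have A: "A p \<in> sets borel" if "p \<in> J \<union> ?I" for p using that by blast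
    define S :: "(real^'n^'n) set" where "S = {N. \<forall>p\<in>J. N $ fst p $ snd p - C $ fst p $ snd p \<in> A p}"
    define S' :: "(real^'n^'n) set" where "S' = {N. \<forall>i. N $ i $ i \<in> A (i, i)}"
    have meas: "{N :: real^'n^'n. N $ i $ j - c \<in> B} \<in> sets borel" if "B \<in> sets borel" for i j c and B :: "real set"
    proof -
      have "(\<lambda>N::real^'n^'n. N $ i $ j - c) \<in> borel_measurable borel"
        by (intro borel_measurable_continuous_onI continuous_intros)
      from measurable_sets[OF this that] show ?thesis
        by (simp add: vimage_def)
    qed
    have "{N \<in> space borel. \<forall>p\<in>J. N $ fst p $ snd p - C $ fst p $ snd p \<in> A p} \<in> sets borel"
      by (rule sets.sets_Collect_finite_All) (simp_all add: meas A)
    then have "S \<in> sets borel"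
      by (simp add: S_def)
    have "{N \<in> space (borel :: (real^'n^'n) measure). \<forall>i\<in>UNIV. N $ i $ i \<in> A (i, i)} \<in> sets borel"
      by (rule sets.sets_Collect_finite_All) (simp_all add: meas[of _ _ _ 0, simplified] A)
    then have "S' \<in> sets borel"
      by (simp add: S'_def)
    have "prob (T -` S \<inter> space M) = (\<Prod>p\<in>J. prob (?X p -` A p \<inter> space M))"
    \<comment> \<open>An empty \<open>J\<close> arises when the matrix to be perturbed is zero; then
      \<open>S\<close> is everything and both sides are 1.\<close>
    proof (cases "J = {}")
      case True
      then show ?thesis by (simp add: S_def prob_space)
    next
      case False
      have "T -` S \<inter> space M = (\<Inter>p\<in>J. G p -` A p \<inter> space M)"
        using False G_eq by (auto simp: S_def)
      also have "prob \<dots> = (\<Prod>p\<in>J. prob (G p -` A p \<inter> space M))"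
        by (rule indep_varsD_finite[OF G False]) (auto intro: A)
      finally show ?thesis by simp
    qed
    moreover have "prob (D -` S' \<inter> space M) = (\<Prod>p\<in>?I. prob (?X p -` A p \<inter> space M))"
    proof -
      have "D -` S' \<inter> space M = (\<Inter>i. (\<lambda>\<omega>. D \<omega> $ i $ i) -` A (i, i) \<inter> space M)"
        by (auto simp: S'_def)
      also have "prob \<dots> = (\<Prod>i\<in>UNIV. prob ((\<lambda>\<omega>. D \<omega> $ i $ i) -` A (i, i) \<inter> space M))"
        by (rule indep_varsD_finite[OF D]) (auto intro: A)
      also have "\<dots> = (\<Prod>p\<in>?I. prob (?X p -` A p \<inter> space M))"
        by (subst prod.reindex) (auto simp: inj_on_def offdiag)
      finally show ?thesis .
    qed
    moreover have "(\<Inter>p\<in>J \<union> ?I. ?X p -` A p \<inter> space M) = (\<lambda>\<omega>. (T \<omega>, D \<omega>)) -` (S \<times> S') \<inter> space M"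
      using G_eq offdiag by (auto simp: S_def S'_def ball_Un) (metis G_eq)
    ultimately show "prob (\<Inter>p\<in>J \<union> ?I. ?X p -` A p \<inter> space M)
      = (\<Prod>p\<in>J \<union> ?I. prob (?X p -` A p \<inter> space M))"
      using indep_varD[OF TD \<open>S \<in> sets borel\<close> \<open>S' \<in> sets borel\<close>] disj
      by (simp add: prod.union_disjoint)
  qed
qed (auto simp: sets.sigma_sets_eq[of borel, simplified] sets.Int_stable)

lemma (in prob_space) distr_indep_gaussians:
  assumes "indep_vars (\<lambda>_. borel) X J" "J \<noteq> {}"
    and gauss: "\<And>p. p \<in> J \<Longrightarrow> distributed M lborel (X p) (normal_density 0 \<sigma>)"
  shows "distr M (Pi\<^sub>M J (\<lambda>_. borel)) (\<lambda>\<omega>. \<lambda>p\<in>J. X p \<omega>) = Pi\<^sub>M J (\<lambda>_. gauss \<sigma>)"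
proof -
  have rv: "random_variable borel (X p)" if "p \<in> J" for p
    using assms(1) that by (auto simp: indep_vars_def)
  have eq: "distr M borel (X p) = gauss \<sigma>" if "p \<in> J" for p
  proof -
    have "distr M borel (X p) = distr M lborel (X p)"
      by (rule distr_cong) auto
    then show ?thesis
      using gauss[OF that] by (simp add: distributed_def)
  qed
  have "distr M (Pi\<^sub>M J (\<lambda>_. borel)) (\<lambda>\<omega>. \<lambda>p\<in>J. X p \<omega>) = Pi\<^sub>M J (\<lambda>p. distr M borel (X p))"
    using indep_vars_iff_distr_eq_PiM'[OF assms(2), where X = X and M' = "\<lambda>_. borel"] rv assms(1) by blast
  also have "\<dots> = Pi\<^sub>M J (\<lambda>_. gauss \<sigma>)"
    by (intro PiM_cong eq refl)
  finally show ?thesis .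
qed

text \<open>The logarithmic factor is at least 1 and is dropped. If x sigma^2 <= 3.2 n^4 the
  remaining bound is at least 1. Otherwise x is large, and n^(7/2) <= n^4, sigma^2 <= |sigma| and
  the gap between 3 and 3.2 suffice.\<close>

lemma tail_bound_arith:
  fixes n x P L :: real
  assumes n: "n \<ge> 2" and L: "L \<ge> 1" and \<sigma>: "0 < \<sigma>\<^sup>2" "\<sigma>\<^sup>2 \<le> 1" and "x > 0"
    and P: "P \<le> 1" "x > 1 \<Longrightarrow> P \<le> sqrt (2 * pi) * n ^ 2 * sqrt n / ((x - 1) / n * \<bar>\<sigma>\<bar>)"
  shows "P \<le> 3.2 * n ^ 4 / (x * \<sigma>\<^sup>2) * L powr (3 / 2)"
proof -
  define w where "w = x * \<sigma>\<^sup>2"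
  have w: "0 < w" "w \<le> x"
    using \<sigma> \<open>x > 0\<close> by (auto simp: w_def intro: mult_left_le)
  have "1 \<le> L powr (3 / 2)"
    using L by (simp add: ge_one_powr_ge_zero)
  then have "3.2 * n ^ 4 / w * 1 \<le> 3.2 * n ^ 4 / w * L powr (3 / 2)"
    using w n by (intro mult_left_mono) auto
  moreover have "P \<le> 3.2 * n ^ 4 / w"
  proof (cases "w \<le> 3.2 * n ^ 4")
    case True
    then have "1 \<le> 3.2 * n ^ 4 / w" using w by (simp add: field_simps)
    then show ?thesis using P(1) by (rule order_trans[rotated])
  next
    case False
    have "2 ^ 4 \<le> n ^ 4" using n by (intro power_mono) auto
    \<comment> \<open>3.2 * 2^4 = 51.2 < w <= x.\<close>
    with False w have x: "x \<ge> 50" by simp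
    have "\<bar>\<sigma>\<bar> * \<bar>\<sigma>\<bar> \<le> \<bar>\<sigma>\<bar> * 1"
      using \<sigma>(2) by (intro mult_left_mono) (simp_all add: abs_square_le_1)
    then have abs: "\<sigma>\<^sup>2 \<le> \<bar>\<sigma>\<bar>"
      by (simp add: power2_eq_square)
    have "sqrt (2 * pi) \<le> sqrt 9"
      using pi_less_4 by (intro real_sqrt_le_mono) simp
    then have s2pi: "sqrt (2 * pi) \<le> 3" by simp
    have "sqrt n \<le> n"
      using n by (intro real_le_lsqrt) (auto simp: power2_eq_square)
    have "P \<le> sqrt (2 * pi) * n ^ 2 * sqrt n / ((x - 1) / n * \<bar>\<sigma>\<bar>)"
      using P(2) x by simp
    also have "\<dots> \<le> 3 * n ^ 2 * n / ((x - 1) / n * \<sigma>\<^sup>2)"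
      using s2pi \<open>sqrt n \<le> n\<close> n x \<sigma> abs by (intro frac_le mult_mono) auto
    also have "\<dots> = 3 / (x - 1) * (n ^ 4 / \<sigma>\<^sup>2)"
      by (simp add: power_numeral_reduce)
    \<comment> \<open>3 / (x - 1) <= 3.2 / x holds as soon as x >= 16.\<close>
    also have "\<dots> \<le> 3.2 / x * (n ^ 4 / \<sigma>\<^sup>2)"
      using x n by (intro mult_right_mono) (auto simp: field_simps)
    finally show ?thesis by (simp add: w_def)
  qed
  ultimately show ?thesis by (simp add: w_def)
qed

theorem theorem6p8:
  fixes M :: "'a measure"
    and Abar Tbar Dbar :: "real^'n::{finite,wellorder}^'n::{finite,wellorder}"
    and T G\<^sub>D D A :: "'a \<Rightarrow> real^'n::{finite,wellorder}^'n::{finite,wellorder}"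
    and \<sigma> x :: real
  assumes "prob_space M"
    and "0 < \<sigma>\<^sup>2" and "\<sigma>\<^sup>2 \<le> 1"
    and "CARD('n) \<ge> 2"
    and "transpose Abar = Abar"
    and "Abar = Tbar + Dbar + transpose Tbar"
    and "onorm ((*v) Abar) \<le> 1"
    and "lower_triangular Tbar" and "\<forall>i. Tbar $ i $ i = 0"
    and "diagonal Dbar"
    and "zero_preserving_perturbation M \<sigma> Tbar T"
    and "\<forall>\<omega>\<in>space M. diagonal (G\<^sub>D \<omega>)"
    and "indep_gaussians M \<sigma> (\<lambda>i \<omega>. G\<^sub>D \<omega> $ i $ i) UNIV"
    and "prob_space.indep_var M borel T borel G\<^sub>D"
    and "D = (\<lambda>\<omega>. Dbar + G\<^sub>D \<omega>)"
    and "A = (\<lambda>\<omega>. T \<omega> + D \<omega> + transpose (T \<omega>))"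
    and "x \<ge> sqrt (2 / pi) * (1 / \<sigma>\<^sup>2)"
  shows "\<P>(\<omega> in M. growth_L (A \<omega>) > ereal x)
    \<le> 3.2 * real CARD('n) ^ 4 / (x * \<sigma>\<^sup>2)
        * (ln (exp 1 * sqrt (pi / 2) * x * \<sigma>\<^sup>2)) powr (3 / 2)"
proof -
  interpret prob_space M by fact
  define J\<^sub>0 where "J\<^sub>0 = {(i, j). Tbar $ i $ j \<noteq> 0}"
  \<comment> \<open>The strictly lower positions perturbed in \<open>T\<close>, together with the
    whole diagonal, whose noise comes from \<open>G\<^sub>D\<close>.\<close>
  define J where "J = J\<^sub>0 \<union> range (\<lambda>i. (i, i))"
  have J\<^sub>0_lower: "j < i" if "(i, j) \<in> J\<^sub>0" for i j
    using that assms(8,9) unfolding J\<^sub>0_def lower_triangular_def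
    by (cases i j rule: linorder_cases) auto
  interpret perturbed_symmetric Abar J \<sigma>
    using assms J\<^sub>0_lower by unfold_locales (auto simp: J_def intro: less_imp_le)
  from assms(11) obtain G where G: "indep_vars (\<lambda>_. borel) G J\<^sub>0"
    "\<And>p. p \<in> J\<^sub>0 \<Longrightarrow> distributed M lborel (G p) (normal_density 0 \<sigma>)"
    "\<And>\<omega> i j. \<omega> \<in> space M \<Longrightarrow> T \<omega> $ i $ j = (if Tbar $ i $ j = 0 then 0 else Tbar $ i $ j + G (i, j) \<omega>)"
    unfolding zero_preserving_perturbation_def indep_gaussians_def J\<^sub>0_def by blast
  have G\<^sub>D: "indep_vars (\<lambda>_. borel) (\<lambda>i \<omega>. G\<^sub>D \<omega> $ i $ i) UNIV"
    "\<And>i. distributed M lborel (\<lambda>\<omega>. G\<^sub>D \<omega> $ i $ i) (normal_density 0 \<sigma>)"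
    using assms(13) unfolding indep_gaussians_def by auto
  define X where "X = (\<lambda>p \<omega>. if p \<in> J\<^sub>0 then G p \<omega> else G\<^sub>D \<omega> $ fst p $ fst p)"
  have "indep_vars (\<lambda>_. borel) X J"
    unfolding X_def J_def
    by (rule indep_vars_offdiag_diag[where C = Tbar, OF _ G(1) _ G\<^sub>D(1) assms(14)])
      (use J\<^sub>0_lower in \<open>auto simp: G(3) J\<^sub>0_def\<close>)
  moreover have "distributed M lborel (X p) (normal_density 0 \<sigma>)" if "p \<in> J" for p
    using that G(2) G\<^sub>D(2) J\<^sub>0_lower by (cases "p \<in> J\<^sub>0") (auto simp: X_def[abs_def])
  moreover have "J \<noteq> {}" by (auto simp: J_def)
  ultimately have law: "distr M (Pi\<^sub>M J (\<lambda>_. borel)) (\<lambda>\<omega>. \<lambda>p\<in>J. X p \<omega>) = gauss_PiM J"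
    by (intro distr_indep_gaussians)
  have rv: "(\<lambda>\<omega>. \<lambda>p\<in>J. X p \<omega>) \<in> measurable M (Pi\<^sub>M J (\<lambda>_. borel))"
    using \<open>indep_vars (\<lambda>_. borel) X J\<close> by (intro measurable_restrict) (simp add: indep_vars_def)
  have A_eq: "A \<omega> = perturbed (\<lambda>p\<in>J. X p \<omega>)" if \<omega>: "\<omega> \<in> space M" for \<omega>
  proof -
    have "A \<omega> $ i $ j = perturbed (\<lambda>p\<in>J. X p \<omega>) $ i $ j" for i j
    proof (cases "i = j")
      case True
      have "(i, i) \<notin> J\<^sub>0" "(i, i) \<in> J"
        using J\<^sub>0_lower[of i i] by (auto simp: J_def)
      with True show ?thesis
        using assms(9) \<omega> by (simp add: assms(6,15,16) transpose_def G(3) noise_def X_def)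
    next
      case False
      have "G\<^sub>D \<omega> $ i $ j = 0"
        using False assms(12) \<omega> by (simp add: diagonal_def)
      moreover have "(i, j) \<in> J \<longleftrightarrow> (i, j) \<in> J\<^sub>0" "(j, i) \<in> J \<longleftrightarrow> (j, i) \<in> J\<^sub>0"
        using False by (auto simp: J_def)
      \<comment> \<open>At most one of two mirrored entries is non-zero, so T + T^T never adds two
        noise terms at one position, in agreement with \<open>noise\<close>.\<close>
      moreover have "Tbar $ i $ j = 0 \<or> Tbar $ j $ i = 0"
        using J\<^sub>0_lower[of i j] J\<^sub>0_lower[of j i] less_asym[of i j] unfolding J\<^sub>0_def by blast
      ultimately show ?thesis
        using \<omega> by (auto simp: assms(6,15,16) transpose_def G(3) noise_def X_def J\<^sub>0_def)
    qed
    then show ?thesis by (simp add: vec_eq_iff)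
  qed
  let ?P = "\<P>(\<omega> in M. growth_L (A \<omega>) > ereal x)"
  have bound: "?P \<le> sqrt (2 * pi) * real CARD('n) ^ 2 * sqrt (real CARD('n)) / ((x - 1) / real CARD('n) * \<bar>\<sigma>\<bar>)"
    (is "_ \<le> ?b") if "x > 1"
  proof -
    \<comment> \<open>Solves 1 + nt = x, the bound on the growth factor outside the exceptional
      set.\<close>
    define t where "t = (x - 1) / real CARD('n)"
    have "t > 0" "1 + real CARD('n) * t = x"
      using \<open>x > 1\<close> by (simp_all add: t_def)
    define E where "E = (\<Union>k. exceptional k t) \<inter> space (gauss_PiM J)"
    have "(\<Union>k. exceptional k t \<inter> space (gauss_PiM J)) \<in> sets (gauss_PiM J)"
      by (intro sets.countable_UN') (auto intro: exceptional_measurable countable_finite)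
    then have E: "E \<in> sets (gauss_PiM J)"
      by (simp add: E_def)
    let ?F = "(\<lambda>\<omega>. \<lambda>p\<in>J. X p \<omega>) -` E \<inter> space M"
    have "emeasure M ?F = emeasure (gauss_PiM J) E"
      using E rv unfolding law[symmetric] by (simp add: emeasure_distr)
    also have "\<dots> \<le> ennreal ?b"
      unfolding E_def using emeasure_Union_exceptional_le[OF \<open>t > 0\<close>] by (simp add: t_def)
    finally have "measure M ?F \<le> ?b"
      using \<open>x > 1\<close> by (simp add: emeasure_eq_measure)
    moreover have "?P \<le> measure M ?F"
    \<comment> \<open>The case split makes a measurability proof for the event unnecessary: outside
      \<open>events\<close> its \<open>measure\<close> is 0 by convention.\<close>
    proof (cases "{\<omega>\<in>space M. growth_L (A \<omega>) > ereal x} \<in> events")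
      case True
      show ?thesis
      proof (rule finite_measure_mono)
        show "{\<omega>\<in>space M. growth_L (A \<omega>) > ereal x} \<subseteq> ?F"
        proof (rule subsetI)
          fix \<omega> assume "\<omega> \<in> {\<omega>\<in>space M. growth_L (A \<omega>) > ereal x}"
          then have \<omega>: "\<omega> \<in> space M" "growth_L (A \<omega>) > ereal x"
            by auto
          then have "(\<lambda>p\<in>J. X p \<omega>) \<in> (\<Union>k. exceptional k t)"
            using growth_L_le_outside_exceptional[of t "\<lambda>p\<in>J. X p \<omega>"] \<open>t > 0\<close>
            by (auto simp: A_eq \<open>1 + real CARD('n) * t = x\<close> not_le[symmetric])
          moreover have "(\<lambda>p\<in>J. X p \<omega>) \<in> space (gauss_PiM J)"
            by (simp add: space_PiM)
          ultimately show "\<omega> \<in> ?F"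
            using \<omega>(1) by (simp add: E_def)
        qed
        show "?F \<in> events"
        proof (rule measurable_sets[OF rv])
          show "E \<in> sets (Pi\<^sub>M J (\<lambda>_. borel))"
            using E unfolding law[symmetric] by simp
        qed
      qed
    qed (simp add: measure_notin_sets)
    ultimately show ?thesis by simp
  qed
  have "sqrt (2 / pi) > 0" by simp
  then have "x > 0"
    using assms(2,17) by (smt (verit) divide_pos_pos mult_pos_pos)
  \<comment> \<open>The lower bound on x says exactly that the argument of the logarithm is at least
    e, so the logarithm is at least 1.\<close>
  have "1 = sqrt (pi / 2) * sqrt (2 / pi)"
    by (simp flip: real_sqrt_mult)
  also have "\<dots> \<le> sqrt (pi / 2) * (x * \<sigma>\<^sup>2)"
    using assms(2,17) by (intro mult_left_mono) (auto simp: field_simps)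
  finally have "exp 1 * 1 \<le> exp 1 * (sqrt (pi / 2) * (x * \<sigma>\<^sup>2))"
    by (intro mult_left_mono) auto
  then have "1 \<le> ln (exp 1 * sqrt (pi / 2) * x * \<sigma>\<^sup>2)"
    by (subst ln_ge_iff) (use \<open>x > 0\<close> assms(2) in \<open>auto simp: mult.assoc\<close>)
  then show ?thesis
    using assms(2-4) \<open>x > 0\<close> bound by (intro tail_bound_arith) auto
qed

end
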